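(* Let $n\ge1$ be an integer. Then $\underline{\mathbf{H}}_{w_n}=\underline{\mathbf{H}}_{s_2}\underline{\mathbf{H}}_{e_n}$.
   Context: $W$ is the affine Weyl group of type $\tilde B_2$: the Coxeter group generated by involutions $S=\{s_0,s_1,s_2\}$ with relations $(s_1s_2)^4=(s_2s_0)^4=(s_1s_0)^2=1$; $\ell$ is the length function and $\le$ the Bruhat order. Hecke algebra $\mathcal{H}$ of $W$ over $\mathbb{Z}[v,v^{-1}]$: generated by $\mathbf{H}_{s}$, $s\in S$, with the braid relations of $W$ and $\mathbf{H}_s^2=(v^{-1}-v)\mathbf{H}_s+1$; standard basis $\{\mathbf{H}_w\}_{w\in W}$, where $\mathbf{H}_w$ is the product of the $\mathbf{H}_s$ along any reduced expression of $w$. The bar involution $d$ is the ring involution with $d(v)=v^{-1}$, $d(\mathbf{H}_w)=\mathbf{H}_{w^{-1}}^{-1}$. The Kazhdan–Lusztig basis $\{\underline{\mathbf{H}}_w\}$ is the unique family of $d$-invariant elements with $\underline{\mathbf{H}}_w\in \mathbf{H}_w+\sum_{x<w}v\mathbb{Z}[v]\mathbf{H}_x$ (so $\underline{\mathbf{H}}_s=\mathbf{H}_s+v$). $\varphi:W\to W$ is the automorphism interchanging $s_0$ and $s_1$ and fixing $s_2$; $w'=\varphi(w)$. Let $\{a_n\}_{n\ge1}=(s_1,s_2,s_1,s_0,s_2,s_0,s_1,s_2,s_1,s_0,s_2,s_0,\ldots)$ (periodic of period 6), $x_n=a_1a_2\cdots a_n$, $e_n=s_1x_n'$ and $w_n=s_2e_n$.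 *)

theory Defs
  imports "HOL-Library.Poly_Mapping"
begin

datatype gen = S0 | S1 | S2

definition word_pow :: "nat \<Rightarrow> gen list \<Rightarrow> gen list" where
  "word_pow k us = concat (replicate k us)"

definition relators :: "gen list set" where
  "relators = {[S0, S0], [S1, S1], [S2, S2],
     word_pow 4 [S1, S2], word_pow 4 [S2, S0], word_pow 2 [S1, S0]}"

text \<open>The generators are involutions, so every group element is represented by a positive word
  and the monoid presented by the same relators is already the group.\<close>

inductive word_eq :: "gen list \<Rightarrow> gen list \<Rightarrow> bool" where
  rel: "r \<in> relators \<Longrightarrow> word_eq (us @ r @ vs) (us @ vs)"
| refl: "word_eq us us"
| sym: "word_eq us vs \<Longrightarrow> word_eq vs us"
| trans: "word_eq us vs \<Longrightarrow> word_eq vs ws \<Longrightarrow> word_eq us ws"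

lemma word_eq_append_left: "word_eq us vs \<Longrightarrow> word_eq (ps @ us) (ps @ vs)"
proof (induction rule: word_eq.induct)
  case (rel r us vs)
  then show ?case using word_eq.rel[of r "ps @ us" vs] by simp
qed (blast intro: word_eq.refl word_eq.sym word_eq.trans)+

lemma word_eq_append_right: "word_eq us vs \<Longrightarrow> word_eq (us @ ps) (vs @ ps)"
proof (induction rule: word_eq.induct)
  case (rel r us vs)
  then show ?case using word_eq.rel[of r us "vs @ ps"] by simp
qed (blast intro: word_eq.refl word_eq.sym word_eq.trans)+

lemma word_eq_append:
  "word_eq us us' \<Longrightarrow> word_eq vs vs' \<Longrightarrow> word_eq (us @ vs) (us' @ vs')"
  by (meson word_eq_append_left word_eq_append_right word_eq.trans)

lemma word_eq_relator: "r \<in> relators \<Longrightarrow> word_eq r []"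
  using word_eq.rel[of r "[]" "[]"] by simp

lemma word_eq_square: "word_eq [s, s] []"
  by (rule word_eq_relator) (cases s; simp add: relators_def)

lemma word_eq_rev_cancel: "word_eq (rev us @ us) []"
proof (induction us)
  case (Cons s us)
  have "word_eq (rev us @ [s, s] @ us) (rev us @ [] @ us)"
    by (intro word_eq_append word_eq_square word_eq.refl)
  then show ?case using word_eq.trans Cons.IH by simp
qed (simp add: word_eq.refl)

lemma word_eq_rev: "word_eq us vs \<Longrightarrow> word_eq (rev us) (rev vs)"
proof -
  assume uv: "word_eq us vs"
  have vv: "word_eq (vs @ rev vs) []"
    using word_eq_rev_cancel[of "rev vs"] by simp
  have "word_eq (rev us) (rev us @ (vs @ rev vs))"
    using word_eq.sym[OF word_eq_append_left[OF vv, of "rev us"]] by simp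
  moreover have "word_eq ((rev us @ vs) @ rev vs) ((rev us @ us) @ rev vs)"
    by (intro word_eq_append_left word_eq_append_right word_eq.sym[OF uv])
  moreover have "word_eq ((rev us @ us) @ rev vs) ([] @ rev vs)"
    by (rule word_eq_append_right[OF word_eq_rev_cancel])
  ultimately show ?thesis by (simp only: append_assoc append_Nil, meson word_eq.trans)
qed

quotient_type weyl = "gen list" / word_eq
  by (intro equivpI reflpI sympI transpI)
    (rule word_eq.refl, erule word_eq.sym, erule (1) word_eq.trans)

instantiation weyl :: monoid_mult
begin

lift_definition one_weyl :: weyl is "[]" .

lift_definition times_weyl :: "weyl \<Rightarrow> weyl \<Rightarrow> weyl" is "(@)"
  by (rule word_eq_append)

instance
  by standard (transfer; simp add: word_eq.refl)+

end

instantiation weyl :: inverse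
begin

lift_definition inverse_weyl :: "weyl \<Rightarrow> weyl" is rev
  by (rule word_eq_rev)

definition divide_weyl :: "weyl \<Rightarrow> weyl \<Rightarrow> weyl" where
  "divide_weyl x y = x * inverse y"

instance ..

end

lemma weyl_left_inverse: "inverse w * w = (1 :: weyl)"
  by transfer (rule word_eq_rev_cancel)

lemma weyl_right_inverse: "w * inverse w = (1 :: weyl)"
proof (transfer)
  fix w show "word_eq (w @ rev w) []" using word_eq_rev_cancel[of "rev w"] by simp
qed

lift_definition of_gen :: "gen \<Rightarrow> weyl" is "\<lambda>s. [s]" .

definition word_val :: "gen list \<Rightarrow> weyl" where
  "word_val us = prod_list (map of_gen us)"

lemma word_val_eq_abs: "word_val us = abs_weyl us"
  by (induction us)
    (simp_all add: word_val_def one_weyl.abs_eq of_gen.abs_eq times_weyl.abs_eq)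

lemma word_val_surj: "\<exists>us. word_val us = w"
  by (induction w) (auto simp: word_val_eq_abs)

definition len :: "weyl \<Rightarrow> nat" where
  "len w = (LEAST k. \<exists>us. length us = k \<and> word_val us = w)"

definition reduced_expr :: "gen list \<Rightarrow> weyl \<Rightarrow> bool" where
  "reduced_expr us w \<longleftrightarrow> word_val us = w \<and> length us = len w"

lemma reduced_expr_exists: "\<exists>us. reduced_expr us w"
proof -
  have "\<exists>us. length us = len w \<and> word_val us = w"
    unfolding len_def by (rule LeastI_ex) (use word_val_surj in blast)
  then show ?thesis by (auto simp: reduced_expr_def)
qed

definition reflections :: "weyl set" where
  "reflections = {w * of_gen s * inverse w | w s. True}"

text \<open>Bruhat order: the reflexive transitive closure of \<open>x \<rightarrow> x * t\<close>, where \<open>t\<close> is a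
  reflection and the length increases.\<close>

definition bruhat_step :: "weyl \<Rightarrow> weyl \<Rightarrow> bool" where
  "bruhat_step x w \<longleftrightarrow> (\<exists>t\<in>reflections. w = x * t) \<and> len x < len w"

lemma bruhat_len: "bruhat_step\<^sup>*\<^sup>* x w \<Longrightarrow> x = w \<or> len x < len w"
  by (induction rule: rtranclp_induct) (auto simp: bruhat_step_def)

instantiation weyl :: order
begin

definition less_eq_weyl :: "weyl \<Rightarrow> weyl \<Rightarrow> bool" where
  "less_eq_weyl = bruhat_step\<^sup>*\<^sup>*"

definition less_weyl :: "weyl \<Rightarrow> weyl \<Rightarrow> bool" where
  "less_weyl x w \<longleftrightarrow> x \<le> w \<and> \<not> w \<le> x"

instance
proof
  fix x y :: weyl
  show "x \<le> y \<Longrightarrow> y \<le> x \<Longrightarrow> x = y"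
    unfolding less_eq_weyl_def by (metis bruhat_len less_asym)
qed (auto simp: less_weyl_def less_eq_weyl_def)

end

lemma less_weyl_len: "x < w \<Longrightarrow> len x < len w" for x w :: weyl
  using bruhat_len[of x w] by (auto simp: less_weyl_def less_eq_weyl_def)

lemma finite_gen_UNIV: "finite (UNIV :: gen set)"
proof -
  have "s \<in> {S0, S1, S2}" for s by (cases s) auto
  then have "(UNIV :: gen set) = {S0, S1, S2}" by blast
  then show ?thesis by (metis finite.emptyI finite_insert)
qed

lemma finite_bruhat_below: "finite {x :: weyl. x < w}"
proof -
  let ?L = "{us :: gen list. set us \<subseteq> UNIV \<and> length us \<le> len w}"
  have "x \<in> word_val ` ?L" if "x < w" for x
  proof -
    obtain us where "reduced_expr us x" using reduced_expr_exists by blast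
    then show ?thesis using less_weyl_len[OF that] by (force simp: reduced_expr_def)
  qed
  then have "{x. x < w} \<subseteq> word_val ` ?L" by (intro subsetI) simp
  moreover have "finite (word_val ` ?L)"
    by (intro finite_imageI finite_lists_length_le finite_gen_UNIV)
  ultimately show ?thesis by (rule finite_subset)
qed

text \<open>Laurent polynomials over the integers: the group ring of the integers, where \<open>single k c\<close>
  is the monomial $c v^k$.\<close>

type_synonym laurent = "int \<Rightarrow>\<^sub>0 int"

definition vv :: laurent where "vv = Poly_Mapping.single 1 1"

definition vinv :: laurent where "vinv = Poly_Mapping.single (- 1) 1"

lemma vv_vinv: "vv * vinv = 1" "vinv * vv = 1"
  by (simp_all add: vv_def vinv_def Poly_Mapping.mult_single)

definition v_Zv :: "laurent set" where
  "v_Zv = {p. \<forall>k\<in>Poly_Mapping.keys p. k > 0}"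

text \<open>The algebra is given by its presentation: formal expressions in scalars and generators,
  modulo the least congruence that contains the axioms of an associative unital algebra over the
  Laurent polynomials and the defining relations.\<close>

datatype hexp = Scal laurent | Gen gen | Plus hexp hexp | Times hexp hexp

inductive hecke_eq :: "hexp \<Rightarrow> hexp \<Rightarrow> bool" where
  refl: "hecke_eq x x"
| sym: "hecke_eq x y \<Longrightarrow> hecke_eq y x"
| trans: "hecke_eq x y \<Longrightarrow> hecke_eq y z \<Longrightarrow> hecke_eq x z"
| plus_cong: "hecke_eq x x' \<Longrightarrow> hecke_eq y y' \<Longrightarrow> hecke_eq (Plus x y) (Plus x' y')"
| times_cong: "hecke_eq x x' \<Longrightarrow> hecke_eq y y' \<Longrightarrow> hecke_eq (Times x y) (Times x' y')"
| plus_assoc: "hecke_eq (Plus (Plus x y) z) (Plus x (Plus y z))"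
| plus_comm: "hecke_eq (Plus x y) (Plus y x)"
| plus_zero: "hecke_eq (Plus (Scal 0) x) x"
| times_assoc: "hecke_eq (Times (Times x y) z) (Times x (Times y z))"
| times_zero_left: "hecke_eq (Times (Scal 0) x) (Scal 0)"
| times_one_left: "hecke_eq (Times (Scal 1) x) x"
| times_one_right: "hecke_eq (Times x (Scal 1)) x"
| distrib_right: "hecke_eq (Times (Plus x y) z) (Plus (Times x z) (Times y z))"
| distrib_left: "hecke_eq (Times x (Plus y z)) (Plus (Times x y) (Times x z))"
| scal_plus: "hecke_eq (Scal (a + b)) (Plus (Scal a) (Scal b))"
| scal_times: "hecke_eq (Scal (a * b)) (Times (Scal a) (Scal b))"
| scal_central: "hecke_eq (Times (Scal a) x) (Times x (Scal a))"
| quadratic: "hecke_eq (Times (Gen s) (Gen s)) (Plus (Times (Scal (vinv - vv)) (Gen s)) (Scal 1))"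
| braid_12: "hecke_eq (Times (Gen S1) (Times (Gen S2) (Times (Gen S1) (Gen S2))))
                      (Times (Gen S2) (Times (Gen S1) (Times (Gen S2) (Gen S1))))"
| braid_20: "hecke_eq (Times (Gen S2) (Times (Gen S0) (Times (Gen S2) (Gen S0))))
                      (Times (Gen S0) (Times (Gen S2) (Times (Gen S0) (Gen S2))))"
| braid_10: "hecke_eq (Times (Gen S1) (Gen S0)) (Times (Gen S0) (Gen S1))"

text \<open>The character sending every generator to $v^{-1}$; it shows that the quotient is not the
  zero ring.\<close>

fun triv_char :: "hexp \<Rightarrow> laurent" where
  "triv_char (Scal a) = a"
| "triv_char (Gen s) = vinv"
| "triv_char (Plus x y) = triv_char x + triv_char y"
| "triv_char (Times x y) = triv_char x * triv_char y"

lemma triv_char_cong: "hecke_eq x y \<Longrightarrow> triv_char x = triv_char y"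
  by (induction rule: hecke_eq.induct) (auto simp: algebra_simps vv_vinv)

quotient_type hecke = hexp / hecke_eq
  by (intro equivpI reflpI sympI transpI)
    (rule hecke_eq.refl, erule hecke_eq.sym, erule (1) hecke_eq.trans)

lift_definition scal :: "laurent \<Rightarrow> hecke" is Scal .

lift_definition Hgen :: "gen \<Rightarrow> hecke" is Gen .

instantiation hecke :: ring_1
begin

lift_definition zero_hecke :: hecke is "Scal 0" .

lift_definition one_hecke :: hecke is "Scal 1" .

lift_definition plus_hecke :: "hecke \<Rightarrow> hecke \<Rightarrow> hecke" is Plus
  by (rule hecke_eq.plus_cong)

lift_definition times_hecke :: "hecke \<Rightarrow> hecke \<Rightarrow> hecke" is Times
  by (rule hecke_eq.times_cong)

lift_definition uminus_hecke :: "hecke \<Rightarrow> hecke" is "Times (Scal (- 1))"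
  by (intro hecke_eq.times_cong hecke_eq.refl)

definition minus_hecke :: "hecke \<Rightarrow> hecke \<Rightarrow> hecke" where
  "minus_hecke x y = x + - y"

instance
proof
  fix a b c :: hecke
  show "a + b + c = a + (b + c)" by transfer (rule hecke_eq.plus_assoc)
  show "a + b = b + a" by transfer (rule hecke_eq.plus_comm)
  show "0 + a = a" by transfer (rule hecke_eq.plus_zero)
  show "a * b * c = a * (b * c)" by transfer (rule hecke_eq.times_assoc)
  show "1 * a = a" by transfer (rule hecke_eq.times_one_left)
  show "a * 1 = a" by transfer (rule hecke_eq.times_one_right)
  show "(a + b) * c = a * c + b * c" by transfer (rule hecke_eq.distrib_right)
  show "a * (b + c) = a * b + a * c" by transfer (rule hecke_eq.distrib_left)
  show "a - b = a + - b" by (rule minus_hecke_def)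
  show "(0 :: hecke) \<noteq> 1" by transfer (auto dest: triv_char_cong)
  show "- a + a = 0"
  proof transfer
    fix x
    let ?m = "Scal (- 1)" and ?o = "Scal 1"
    have "hecke_eq (Plus (Times ?m x) x) (Plus (Times ?m x) (Times ?o x))"
      by (intro hecke_eq.plus_cong hecke_eq.refl hecke_eq.sym[OF hecke_eq.times_one_left])
    moreover have "hecke_eq (Plus (Times ?m x) (Times ?o x)) (Times (Plus ?m ?o) x)"
      by (rule hecke_eq.sym[OF hecke_eq.distrib_right])
    moreover have "hecke_eq (Times (Plus ?m ?o) x) (Times (Scal 0) x)"
      using hecke_eq.scal_plus[of "- 1" 1]
      by (intro hecke_eq.times_cong hecke_eq.refl) (simp add: hecke_eq.sym)
    moreover have "hecke_eq (Times (Scal 0) x) (Scal 0)"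
      by (rule hecke_eq.times_zero_left)
    ultimately show "hecke_eq (Plus (Times ?m x) x) (Scal 0)"
      by (meson hecke_eq.trans)
  qed
qed

end

text \<open>Any choice of reduced expression gives the same product, by the braid relations.\<close>

definition Hstd :: "weyl \<Rightarrow> hecke" where
  "Hstd w = prod_list (map Hgen (SOME us. reduced_expr us w))"

definition is_bar_involution :: "(hecke \<Rightarrow> hecke) \<Rightarrow> bool" where
  "is_bar_involution d \<longleftrightarrow>
     d 1 = 1 \<and> (\<forall>x y. d (x + y) = d x + d y) \<and> (\<forall>x y. d (x * y) = d x * d y) \<and>
     (\<forall>x. d (d x) = x) \<and> d (scal vv) = scal vinv \<and>
     (\<forall>w. d (Hstd w) * Hstd (inverse w) = 1 \<and> Hstd (inverse w) * d (Hstd w) = 1)"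

definition bar :: "hecke \<Rightarrow> hecke" where
  "bar = (THE d. is_bar_involution d)"

definition is_KL :: "weyl \<Rightarrow> hecke \<Rightarrow> bool" where
  "is_KL w h \<longleftrightarrow> bar h = h \<and>
     (\<exists>p. (\<forall>x. p x \<in> v_Zv) \<and> h = Hstd w + (\<Sum>x | x < w. scal (p x) * Hstd x))"

definition KL :: "weyl \<Rightarrow> hecke" where
  "KL w = (THE h. is_KL w h)"

fun swap01 :: "gen \<Rightarrow> gen" where
  "swap01 S0 = S1"
| "swap01 S1 = S0"
| "swap01 S2 = S2"

lemma word_eq_swap01_relator: "r \<in> relators \<Longrightarrow> word_eq (map swap01 r) []"
proof -
  assume "r \<in> relators"
  then have "map swap01 r \<in> relators \<or> rev (map swap01 r) \<in> relators"
    by (auto simp: relators_def word_pow_def numeral_eq_Suc)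
  then show ?thesis
  proof
    assume "rev (map swap01 r) \<in> relators"
    then show ?thesis using word_eq_rev[OF word_eq_relator] by fastforce
  qed (rule word_eq_relator)
qed

lift_definition phi :: "weyl \<Rightarrow> weyl" is "map swap01"
proof -
  fix us vs assume "word_eq us vs"
  then show "word_eq (map swap01 us) (map swap01 vs)"
  proof (induction rule: word_eq.induct)
    case (rel r us vs)
    have "word_eq (map swap01 us @ map swap01 r @ map swap01 vs)
                  (map swap01 us @ [] @ map swap01 vs)"
      by (intro word_eq_append word_eq.refl word_eq_swap01_relator rel)
    then show ?case by simp
  qed (blast intro: word_eq.refl word_eq.sym word_eq.trans)+
qed

lemma phi_of_gen: "phi (of_gen s) = of_gen (swap01 s)"
  by transfer (simp add: word_eq.refl)

lemma phi_mult: "phi (x * y) = phi x * phi y"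
  by transfer (simp add: word_eq.refl)

lemma phi_phi: "phi (phi w) = w"
proof transfer
  have "swap01 \<circ> swap01 = id" by (rule ext) (case_tac x; simp)
  then show "word_eq (map swap01 (map swap01 w)) w" for w by (simp add: word_eq.refl)
qed

text \<open>The sequences are indexed from 1; the values at 0 are irrelevant.\<close>

definition a_seq :: "nat \<Rightarrow> gen" where
  "a_seq n = [S1, S2, S1, S0, S2, S0] ! ((n - 1) mod 6)"

definition x_elt :: "nat \<Rightarrow> weyl" where
  "x_elt n = prod_list (map (\<lambda>i. of_gen (a_seq i)) [1..<Suc n])"

definition e_elt :: "nat \<Rightarrow> weyl" where
  "e_elt n = of_gen S1 * phi (x_elt n)"

definition w_elt :: "nat \<Rightarrow> weyl" where
  "w_elt n = of_gen S2 * e_elt n"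

end

theory Submission
  imports Defs
begin

text \<open>For a generator \<open>s\<close> that is not a left descent of \<open>u\<close>, the
  product of the Kazhdan-Lusztig elements of \<open>s\<close> and \<open>u\<close> is that of
  \<open>s u\<close> plus the sum of all \<open>\<mu>(z, u)\<close> times that of
  \<open>z\<close>, over the \<open>z < u\<close> with left descent \<open>s\<close>
  (\<open>KL_mult_gen\<close>). Here \<open>\<mu>(z, u)\<close> is the coefficient of
  \<open>v\<close> in the coordinate of \<open>KL u\<close> at the standard basis element of
  \<open>z\<close>. The theorem says that for \<open>s = s\<^sub>2\<close> and \<open>u =
  e\<^sub>n\<close> nothing is added, so it suffices that \<open>\<mu>(z, e\<^sub>n)\<close>
  vanishes whenever \<open>s\<^sub>2\<close> is a left descent of \<open>z\<close>
  (\<open>KL_mu_e_elt\<close>).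

  If \<open>\<mu>(z, w) \<noteq> 0\<close>, a left descent \<open>t\<close> of \<open>w\<close> is
  also one of \<open>z\<close> unless \<open>z = t w\<close> (\<open>KL_mu_ldesc\<close>). The
  left descents of \<open>e\<^sub>n\<close> are \<open>s\<^sub>0\<close> and
  \<open>s\<^sub>1\<close>, and neither \<open>s\<^sub>0 e\<^sub>n\<close> nor \<open>s\<^sub>1
  e\<^sub>n\<close> has the left descent \<open>s\<^sub>2\<close>. A \<open>z\<close> with
  \<open>\<mu>(z, e\<^sub>n) \<noteq> 0\<close> and left descent \<open>s\<^sub>2\<close> would
  thus have all generators as left descents. It would lie above every element in the Bruhat order,
  which is impossible in an infinite group (\<open>not_all_ldesc\<close>). The descents of the
  special elements are read off from the affine action on the plane: the words describe a periodic
  walk through the triangles of the tiling, and a generator is not a left descent if the walk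
  stays on the side of its mirror that contains the base point (\<open>not_ldesc_walk\<close>).

  The general theory is derived from the presentation. The parity cocycle of reflections gives the
  exchange condition; this yields Matsumoto's theorem, so that the standard basis multiplies as
  expected, and the commutation of left and right multiplication operators, so that the regular
  representation exists and the standard basis is linearly independent. The bar involution is
  unitriangular, hence a bar-invariant element with all coefficients in \<open>v \<int>[v]\<close>
  is zero, and Kazhdan-Lusztig elements are unique; the multiplication rule above constructs
  them.\<close>

section \<open>Calculation in the presented group\<close>

lemma inverse_mult_weyl: "inverse (x * y) = inverse y * inverse (x :: weyl)"
  by transfer (simp add: word_eq.refl)

lemma inverse_inverse_weyl [simp]: "inverse (inverse x) = (x :: weyl)"
  by transfer (simp add: word_eq.refl)

lemma inverse_of_gen [simp]: "inverse (of_gen s) = of_gen s"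
  by transfer (simp add: word_eq.refl)

lemma of_gen_square [simp]: "of_gen s * of_gen s = 1"
  by transfer (simp add: word_eq_square)

lemma inverse_one_weyl [simp]: "inverse 1 = (1 :: weyl)"
  by transfer (simp add: word_eq.refl)

lemma weyl_cancel [simp]:
  "inverse x * (x * y) = (y :: weyl)" "x * (inverse x * y) = y"
  "of_gen s * (of_gen s * y) = y"
  by (simp_all flip: mult.assoc add: weyl_left_inverse weyl_right_inverse)

lemma weyl_left_cancel [simp]: "x * y = x * z \<longleftrightarrow> y = (z :: weyl)"
  by (metis weyl_cancel(1))

lemma word_val_simps [simp]:
  "word_val [] = 1" "word_val (s # us) = of_gen s * word_val us"
  "word_val (us @ vs) = word_val us * word_val vs"
  by (simp_all add: word_val_def)

lemma word_val_rev: "word_val (rev us) = inverse (word_val us)"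
  by (simp add: word_val_eq_abs inverse_weyl.abs_eq)

lemma relator_word_val: "r \<in> relators \<Longrightarrow> word_val r = 1"
  by (simp add: word_val_eq_abs one_weyl.abs_eq word_eq_relator weyl.abs_eq_iff)

lemma len_word_val_le: "len (word_val us) \<le> length us"
  unfolding len_def by (rule Least_le) blast

section \<open>The reflection cocycle and left descents\<close>

text \<open>The entry of \<open>inv_refls (s\<^sub>1 \<dots> s\<^sub>k)\<close> at position
  \<open>i\<close> is the conjugate of \<open>s\<^sub>i\<close> by \<open>s\<^sub>1 \<dots>
  s\<^bsub>i-1\<^esub>\<close>, the reflection that deletes the letter \<open>s\<^sub>i\<close>
  when it multiplies the word from the left. The parity with which a reflection occurs in this
  list depends on the group element only; this parity is the cocycle from which the exchange
  condition and the descents are read off.\<close>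

primrec inv_refls :: "gen list \<Rightarrow> weyl list" where
  "inv_refls [] = []"
| "inv_refls (s # us) = of_gen s # map (\<lambda>t. of_gen s * t * of_gen s) (inv_refls us)"

lemma inv_refls_append:
  "inv_refls (us @ vs) =
    inv_refls us @ map (\<lambda>t. word_val us * t * inverse (word_val us)) (inv_refls vs)"
  by (induction us) (simp_all add: inverse_mult_weyl mult.assoc)

lemma conj_eq_iff: "x * t * inverse x = r \<longleftrightarrow> t = inverse x * r * (x :: weyl)"
  by (metis mult.assoc mult.right_neutral weyl_cancel weyl_left_inverse weyl_right_inverse)

lemma count_list_conj:
  "count_list (map (\<lambda>t. x * t * inverse x) ts) r = count_list ts (inverse x * r * (x :: weyl))"
  by (induction ts) (auto simp: conj_eq_iff)

definition odd_refl :: "gen list \<Rightarrow> weyl \<Rightarrow> bool" where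
  "odd_refl us t \<longleftrightarrow> odd (count_list (inv_refls us) t)"

lemma odd_refl_append:
  "odd_refl (us @ vs) t \<longleftrightarrow>
    odd_refl us t \<noteq> odd_refl vs (inverse (word_val us) * t * word_val us)"
  by (auto simp: odd_refl_def inv_refls_append count_list_conj)

lemma inv_refls_commute:
  assumes "\<forall>s\<in>set us. P * of_gen s = of_gen s * P" "t \<in> set (inv_refls us)"
  shows "P * t = t * P"
  using assms by (induction us arbitrary: t) (auto simp: mult.assoc, metis mult.assoc)

text \<open>The second copy of \<open>p\<close> contributes the reflections of the first copy
  conjugated by the value of \<open>p\<close>. This conjugation is trivial, so every reflection
  occurs twice as often as in \<open>p\<close>. Every defining relator has this form:
  \<open>p\<close> is the longest element of the dihedral parabolic subgroup, or a single
  letter.\<close>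

lemma odd_refl_square:
  assumes "\<forall>s\<in>set p. word_val p * of_gen s = of_gen s * word_val p"
  shows "\<not> odd_refl (p @ p) t"
proof -
  have "map (\<lambda>t. word_val p * t * inverse (word_val p)) (inv_refls p) = inv_refls p"
    using inv_refls_commute[OF assms] by (intro map_idI) (simp add: mult.assoc weyl_right_inverse)
  then show ?thesis by (simp add: odd_refl_def inv_refls_append)
qed

lemma eq_of_mult_inverse: "x * y = 1 \<Longrightarrow> x = inverse (y :: weyl)"
  by (metis mult.assoc mult.left_neutral mult.right_neutral weyl_right_inverse)

text \<open>A relator that is a square \<open>p p\<close> says that \<open>p\<close> is its own
  inverse, which is \<open>p\<close> reversed.\<close>

lemma weyl_braid:
  "of_gen S1 * (of_gen S2 * (of_gen S1 * of_gen S2)) = of_gen S2 * (of_gen S1 * (of_gen S2 * of_gen S1))"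
  "of_gen S2 * (of_gen S0 * (of_gen S2 * of_gen S0)) = of_gen S0 * (of_gen S2 * (of_gen S0 * of_gen S2))"
  "of_gen S1 * of_gen S0 = of_gen S0 * of_gen S1"
proof -
  have *: "word_val p = inverse (word_val p)" if "p @ p \<in> relators" for p
    using relator_word_val[OF that] by (intro eq_of_mult_inverse) simp
  show "of_gen S1 * (of_gen S2 * (of_gen S1 * of_gen S2)) = of_gen S2 * (of_gen S1 * (of_gen S2 * of_gen S1))"
    using *[of "[S1, S2, S1, S2]"]
    by (simp add: relators_def word_pow_def numeral_eq_Suc inverse_mult_weyl mult.assoc)
  show "of_gen S2 * (of_gen S0 * (of_gen S2 * of_gen S0)) = of_gen S0 * (of_gen S2 * (of_gen S0 * of_gen S2))"
    using *[of "[S2, S0, S2, S0]"]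
    by (simp add: relators_def word_pow_def numeral_eq_Suc inverse_mult_weyl mult.assoc)
  show "of_gen S1 * of_gen S0 = of_gen S0 * of_gen S1"
    using *[of "[S1, S0]"]
    by (simp add: relators_def word_pow_def numeral_eq_Suc inverse_mult_weyl mult.assoc)
qed

lemma odd_refl_relator:
  assumes "r \<in> relators"
  shows "\<not> odd_refl r t"
proof -
  have *: "\<not> odd_refl ([s, s'] @ [s, s'] @ [s, s'] @ [s, s']) t"
    if braid: "of_gen s * (of_gen s' * (of_gen s * of_gen s')) =
      of_gen s' * (of_gen s * (of_gen s' * of_gen s))"
    for s s'
  proof -
    let ?a = "of_gen s" and ?b = "of_gen s'"
    have "?a * (?b * (?a * (?b * ?a))) = ?a * (?a * (?b * (?a * ?b)))"
      by (simp only: braid[symmetric])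
    moreover have "?a * (?b * (?a * (?b * ?b))) = ?b * (?a * (?b * (?a * ?b)))"
      using arg_cong[OF braid, of "\<lambda>x. x * ?b"] by (simp only: mult.assoc)
    ultimately have "\<not> odd_refl (([s, s'] @ [s, s']) @ ([s, s'] @ [s, s'])) t"
      by (intro odd_refl_square) (auto simp: mult.assoc simp del: weyl_cancel of_gen_square)
    then show ?thesis by simp
  qed
  consider s where "r = [s] @ [s]" | "r = word_pow 4 [S1, S2]" | "r = word_pow 4 [S2, S0]"
    | "r = [S1, S0] @ [S1, S0]"
    using assms by (auto simp: relators_def word_pow_def numeral_eq_Suc)
  then show ?thesis
  proof cases
    case (1 s)
    then show ?thesis using odd_refl_square[of "[s]"] by simp
  next
    case 2
    then show ?thesis using *[of S1 S2] weyl_braid by (simp add: word_pow_def numeral_eq_Suc)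
  next
    case 3
    then show ?thesis using *[of S2 S0] weyl_braid by (simp add: word_pow_def numeral_eq_Suc)
  next
    case 4
    let ?a = "of_gen S1" and ?b = "of_gen S0"
    have "?a * (?b * ?a) = ?a * (?a * ?b)"
      by (simp only: weyl_braid(3))
    moreover have "?a * (?b * ?b) = ?b * (?a * ?b)"
      using arg_cong[OF weyl_braid(3), of "\<lambda>x. x * ?b"] by (simp only: mult.assoc)
    ultimately show ?thesis
      unfolding 4
      by (intro odd_refl_square) (auto simp: mult.assoc simp del: weyl_cancel of_gen_square)
  qed
qed

text \<open>On reflections \<open>t\<close> this is the relation \<open>t w < w\<close>, see
  \<open>len_reflection_less_iff\<close> below.\<close>

lift_definition inversion :: "weyl \<Rightarrow> weyl \<Rightarrow> bool" is "\<lambda>us. odd_refl us"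
proof -
  fix us vs assume "word_eq us vs"
  then show "odd_refl us = odd_refl vs"
  proof (induction rule: word_eq.induct)
    case (rel r us vs)
    then show ?case
      by (intro ext) (simp add: odd_refl_append odd_refl_relator relator_word_val)
  qed auto
qed

lemma inversion_word_val: "inversion (word_val us) t \<longleftrightarrow> odd_refl us t"
  by (simp add: word_val_eq_abs inversion.abs_eq)

lemma inversion_one [simp]: "\<not> inversion 1 t"
  using inversion_word_val[of "[]"] by (simp add: odd_refl_def)

lemma inversion_of_gen [simp]: "inversion (of_gen s) t \<longleftrightarrow> t = of_gen s"
  using inversion_word_val[of "[s]"] by (auto simp add: odd_refl_def)

lemma inversion_mult:
  "inversion (x * y) t \<longleftrightarrow> inversion x t \<noteq> inversion y (inverse x * t * x)"
proof -
  obtain us vs where "x = word_val us" "y = word_val vs" using word_val_surj by metis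
  then show ?thesis
    using odd_refl_append[of us vs t] inversion_word_val[of "us @ vs"] by (simp add: inversion_word_val)
qed

lemma inversion_inverse: "inversion (inverse x) t \<longleftrightarrow> inversion x (x * t * inverse x)"
  using inversion_mult[of "inverse x" x t] by (simp add: weyl_left_inverse)

lemma of_gen_reflection [simp]: "of_gen s \<in> reflections"
  unfolding reflections_def
  by (rule CollectI, rule exI[of _ 1], rule exI[of _ s]) (simp add: eq_of_mult_inverse[of 1 1, symmetric])

lemma reflection_conj: "t \<in> reflections \<Longrightarrow> x * t * inverse x \<in> reflections"
  unfolding reflections_def
proof clarify
  fix w s
  show "\<exists>w' s'. x * (w * of_gen s * inverse w) * inverse x = w' * of_gen s' * inverse w' \<and> True"
    by (rule exI[of _ "x * w"], rule exI[of _ s]) (simp add: inverse_mult_weyl mult.assoc)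
qed

lemma reflection_square: "t \<in> reflections \<Longrightarrow> t * t = 1"
  by (auto simp: reflections_def mult.assoc weyl_right_inverse)

lemma inversion_self: "t \<in> reflections \<Longrightarrow> inversion t t"
  unfolding reflections_def
  by (auto simp: mult.assoc inversion_mult inversion_inverse weyl_left_inverse weyl_right_inverse
    inverse_mult_weyl)

text \<open>The strong exchange condition, in the form in which it is immediate from words.\<close>

lemma delete_letter:
  "t \<in> set (inv_refls us) \<Longrightarrow> \<exists>vs. Suc (length vs) = length us \<and> t * word_val us = word_val vs"
proof (induction us arbitrary: t)
  case (Cons s us)
  show ?case
  proof (cases "t = of_gen s")
    case True
    then show ?thesis by (intro exI[of _ us]) simp
  next
    case False
    then obtain t' where t': "t' \<in> set (inv_refls us)" "t = of_gen s * t' * of_gen s"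
      using Cons.prems by auto
    then obtain vs where "Suc (length vs) = length us" "t' * word_val us = word_val vs"
      using Cons.IH by blast
    then show ?thesis using t' by (intro exI[of _ "s # vs"]) (simp add: mult.assoc)
  qed
qed simp

lemma inversion_len_less: "inversion w t \<Longrightarrow> len (t * w) < len w"
proof -
  assume inv: "inversion w t"
  obtain us where us: "word_val us = w" "length us = len w"
    using reduced_expr_exists[of w] by (auto simp: reduced_expr_def)
  have "t \<in> set (inv_refls us)"
    using inv unfolding us(1)[symmetric] inversion_word_val odd_refl_def
    by (metis count_list_0_iff dvd_0_right)
  then obtain vs where vs: "Suc (length vs) = length us" "t * word_val us = word_val vs"
    using delete_letter by blast
  then show ?thesis using len_word_val_le[of vs] us by simp
qed

text \<open>A reflection inverts itself. By the cocycle rule it is then an inversion of exactly one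
  of \<open>w\<close> and \<open>t w\<close>, and deleting a letter shortens that one.\<close>

lemma len_reflection_less_iff:
  assumes "t \<in> reflections"
  shows "len (t * w) < len w \<longleftrightarrow> inversion w t"
proof
  show "inversion w t" if "len (t * w) < len w"
  proof (rule ccontr)
    assume "\<not> inversion w t"
    moreover have "inverse t = t"
      using reflection_square[OF assms] eq_of_mult_inverse by metis
    ultimately have "inversion (t * w) t"
      using inversion_self[OF assms] reflection_square[OF assms] by (simp add: inversion_mult)
    from inversion_len_less[OF this] that show False
      by (simp flip: mult.assoc add: reflection_square[OF assms])
  qed
qed (rule inversion_len_less)

lemma len_reflection_greater:
  assumes "t \<in> reflections" "\<not> inversion w t"
  shows "len w < len (t * w)"
proof -
  have "inverse t = t"
    using reflection_square[OF assms(1)] eq_of_mult_inverse by metis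
  then have "inversion (t * w) t"
    using inversion_self[OF assms(1)] reflection_square[OF assms(1)] assms(2)
    by (simp add: inversion_mult)
  from inversion_len_less[OF this] show ?thesis
    by (simp flip: mult.assoc add: reflection_square[OF assms(1)])
qed

definition ldesc :: "gen \<Rightarrow> weyl \<Rightarrow> bool" where
  "ldesc s w \<longleftrightarrow> inversion w (of_gen s)"

lemma ldesc_mult_self [simp]: "ldesc s (of_gen s * w) \<longleftrightarrow> \<not> ldesc s w"
  by (simp add: ldesc_def inversion_mult)

lemma len_mult_le: "len (x * y) \<le> len x + len y"
proof -
  obtain us vs where "reduced_expr us x" "reduced_expr vs y" using reduced_expr_exists by blast
  then show ?thesis using len_word_val_le[of "us @ vs"] by (simp add: reduced_expr_def)
qed

lemma len_one [simp]: "len 1 = 0"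
  using len_word_val_le[of "[]"] by simp

lemma len_of_gen_le: "len (of_gen s) \<le> 1"
  using len_word_val_le[of "[s]"] by simp

lemma len_mult_gen:
  "len (of_gen s * w) = (if ldesc s w then len w - 1 else Suc (len w))"
  "ldesc s w \<Longrightarrow> 0 < len w"
proof -
  have up: "len (of_gen s * w) = Suc (len w)" if "\<not> ldesc s w" for w
    using len_reflection_greater[of "of_gen s" w] that len_mult_le[of "of_gen s" w] len_of_gen_le[of s]
    by (simp add: ldesc_def)
  then show "len (of_gen s * w) = (if ldesc s w then len w - 1 else Suc (len w))"
    using up[of "of_gen s * w"] by auto
  show "ldesc s w \<Longrightarrow> 0 < len w" using up[of "of_gen s * w"] by simp
qed

lemma len_inverse [simp]: "len (inverse w) = len w"
proof -
  have "len (inverse w) \<le> len w" for w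
  proof -
    obtain us where "reduced_expr us w" using reduced_expr_exists by blast
    then show ?thesis using len_word_val_le[of "rev us"]
      by (simp add: reduced_expr_def word_val_rev)
  qed
  from this[of w] this[of "inverse w"] show ?thesis by simp
qed

lemma len_pos_ldesc:
  assumes "w \<noteq> 1"
  shows "\<exists>s. ldesc s w"
proof -
  obtain us where us: "word_val us = w" "length us = len w"
    using reduced_expr_exists[of w] by (auto simp: reduced_expr_def)
  with assms obtain s vs where "us = s # vs" by (cases us) auto
  then have "of_gen s * w = word_val vs" "length vs < len w" using us by auto
  then have "len (of_gen s * w) < len w" using len_word_val_le[of vs] by simp
  then show ?thesis unfolding ldesc_def using len_reflection_less_iff of_gen_reflection by blast
qed

lemma weyl_left_induct [case_names one mult]:
  assumes "P 1" "\<And>s w. \<not> ldesc s w \<Longrightarrow> P w \<Longrightarrow> P (of_gen s * w)"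
  shows "P w"
proof (induction "len w" arbitrary: w rule: less_induct)
  case less
  show ?case
  proof (cases "w = 1")
    case False
    then obtain s where s: "ldesc s w" using len_pos_ldesc by blast
    then have "P (of_gen s * w)" using len_mult_gen[of s w] by (intro less) simp
    then show ?thesis using assms(2)[of s "of_gen s * w"] s by simp
  qed (simp add: assms)
qed

section \<open>The affine action\<close>

text \<open>The reflections in the sides of the triangle \<open>0 < x < y < 3\<close>. The scale is
  chosen so that the interior point \<open>(1, 2)\<close> is integral. The form \<open>wall
  s\<close> below vanishes on the mirror of \<open>s\<close>, and all three forms are positive on
  the triangle.\<close>

fun act :: "gen \<Rightarrow> int \<times> int \<Rightarrow> int \<times> int" where
  "act S1 (x, y) = (- x, y)"
| "act S2 (x, y) = (y, x)"
| "act S0 (x, y) = (x, 6 - y)"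

primrec act_word :: "gen list \<Rightarrow> int \<times> int \<Rightarrow> int \<times> int" where
  "act_word [] p = p"
| "act_word (s # us) p = act s (act_word us p)"

lemma act_word_append: "act_word (us @ vs) p = act_word us (act_word vs p)"
  by (induction us) auto

lift_definition action :: "weyl \<Rightarrow> int \<times> int \<Rightarrow> int \<times> int" is act_word
proof -
  have r: "act_word r p = p" if "r \<in> relators" for r p
    using that by (cases p) (auto simp: relators_def word_pow_def numeral_eq_Suc)
  fix us vs assume "word_eq us vs"
  then show "act_word us = act_word vs"
    by (induction rule: word_eq.induct) (auto simp: r fun_eq_iff act_word_append)
qed

lemma action_simps [simp]:
  "action 1 p = p" "action (x * y) p = action x (action y p)" "action (of_gen s) p = act s p"
  by (transfer; simp add: act_word_append)+

fun wall :: "gen \<Rightarrow> int \<times> int \<Rightarrow> int" where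
  "wall S1 (x, y) = x"
| "wall S2 (x, y) = y - x"
| "wall S0 (x, y) = 3 - y"

lemma wall_act: "wall s (act s p) = - wall s p"
  by (cases s; cases p) auto

text \<open>Appending a letter moves the image of the base point across a single mirror, that of the
  reflection \<open>y * a * inverse y\<close>. The left descent \<open>s\<close> can appear only
  if this reflection is \<open>s\<close>, and then \<open>wall s\<close> changes sign.\<close>

lemma not_ldesc_step:
  assumes "\<not> ldesc s y" "0 < wall s (action y (1, 2))" "0 < wall s (action (y * of_gen a) (1, 2))"
  shows "\<not> ldesc s (y * of_gen a)"
proof -
  let ?p = "(1, 2) :: int \<times> int"
  have "inverse y * of_gen s * y \<noteq> of_gen a"
  proof
    assume "inverse y * of_gen s * y = of_gen a"
    then have "y * of_gen a = of_gen s * y" by (metis mult.assoc weyl_cancel(2))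
    then have "wall s (action (y * of_gen a) ?p) = - wall s (action y ?p)"
      by (metis action_simps(2,3) wall_act)
    then show False using assms(2,3) by simp
  qed
  then show ?thesis using assms(1) by (simp add: ldesc_def inversion_mult)
qed

lemma not_ldesc_word:
  assumes "\<not> ldesc s y" "\<forall>k\<le>length us. 0 < wall s (action (y * word_val (take k us)) (1, 2))"
  shows "\<not> ldesc s (y * word_val us)"
  using assms
proof (induction us arbitrary: y)
  case (Cons a us)
  have k: "0 < wall s (action (y * of_gen a * word_val (take k us)) (1, 2))"
    if "k \<le> length us" for k
    using Cons.prems(2)[rule_format, of "Suc k"] that by simp
  have "\<not> ldesc s (y * of_gen a)"
    using Cons.prems(1) Cons.prems(2)[rule_format, of 0] k[of 0] by (intro not_ldesc_step) simp_all
  then show ?case using Cons.IH[of "y * of_gen a"] k by (simp add: mult.assoc)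
qed simp

section \<open>Bruhat order and left descents\<close>

lemma of_gen_eq_iff [simp]: "of_gen s = of_gen t \<longleftrightarrow> s = t"
proof
  assume "of_gen s = of_gen t"
  then have "act s (1, 2) = act t (1, 2)" by (metis action_simps(3))
  then show "s = t" by (cases s; cases t) auto
qed simp

text \<open>Left and right multiplication by reflections give the same steps, because reflections are
  closed under conjugation; the left version matches the cocycle.\<close>

lemma bruhat_step_left_iff:
  "bruhat_step x y \<longleftrightarrow> (\<exists>r\<in>reflections. y = r * x \<and> \<not> inversion x r)"
proof
  assume "bruhat_step x y"
  then obtain t where t: "t \<in> reflections" "y = x * t" "len x < len y"
    by (auto simp: bruhat_step_def)
  then have "y = x * t * inverse x * x" by (simp add: mult.assoc weyl_left_inverse)
  moreover have "x * t * inverse x \<in> reflections" by (rule reflection_conj[OF t(1)])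
  ultimately show "\<exists>r\<in>reflections. y = r * x \<and> \<not> inversion x r"
    using inversion_len_less t(3) by (metis less_asym)
next
  assume "\<exists>r\<in>reflections. y = r * x \<and> \<not> inversion x r"
  then obtain r where r: "r \<in> reflections" "y = r * x" "\<not> inversion x r" by blast
  have "inverse x * r * x \<in> reflections" using reflection_conj[OF r(1), of "inverse x"] by simp
  moreover have "y = x * (inverse x * r * x)" using r(2) by (simp add: mult.assoc)
  moreover have "len x < len y" using len_reflection_greater[OF r(1,3)] r(2) by simp
  ultimately show "bruhat_step x y" unfolding bruhat_step_def by (intro conjI bexI)
qed

text \<open>Left multiplication by \<open>s\<close> conjugates the reflection \<open>r\<close> of the
  step by \<open>s\<close>. By the cocycle rule this keeps the direction of the step, unless
  \<open>r\<close> is \<open>s\<close> itself.\<close>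

lemma bruhat_step_mult_gen:
  assumes "bruhat_step x y"
  shows "y = of_gen s * x \<or> bruhat_step (of_gen s * x) (of_gen s * y)"
proof -
  obtain r where r: "r \<in> reflections" "y = r * x" "\<not> inversion x r"
    using assms bruhat_step_left_iff by blast
  show ?thesis
  proof (cases "r = of_gen s")
    case False
    let ?r = "of_gen s * r * of_gen s"
    have "?r \<in> reflections" using reflection_conj[OF r(1), of "of_gen s"] by simp
    moreover have "of_gen s * y = ?r * (of_gen s * x)" using r(2) by (simp add: mult.assoc)
    moreover have "?r \<noteq> of_gen s"
      using False conj_eq_iff[of "of_gen s" r "of_gen s"] by simp
    then have "\<not> inversion (of_gen s * x) ?r"
      using r(3) by (simp add: inversion_mult) (simp add: mult.assoc)
    ultimately show ?thesis unfolding bruhat_step_left_iff by blast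
  qed (use r in simp)
qed

lemma bruhat_lifting: "x \<le> w \<Longrightarrow> of_gen s * x \<le> w \<or> of_gen s * x \<le> of_gen s * w"
  unfolding less_eq_weyl_def
proof (induction rule: converse_rtranclp_induct)
  case (step x y)
  then show ?case using bruhat_step_mult_gen[OF step(1), of s]
    by (metis converse_rtranclp_into_rtranclp)
qed simp

lemma less_mult_gen:
  assumes "\<not> ldesc s w"
  shows "w < of_gen s * w"
proof -
  have "bruhat_step w (of_gen s * w)"
    using assms unfolding bruhat_step_left_iff ldesc_def
    by (intro bexI[of _ "of_gen s"]) simp_all
  then have "w \<le> of_gen s * w" by (auto simp: less_eq_weyl_def)
  moreover have "w \<noteq> of_gen s * w" using ldesc_mult_self[of s w] by metis
  ultimately show ?thesis by simp
qed

lemma mult_gen_less: "ldesc s w \<Longrightarrow> of_gen s * w < w"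
  using less_mult_gen[of s "of_gen s * w"] by simp

lemma bruhat_lifting_up: "\<not> ldesc s w \<Longrightarrow> x \<le> w \<Longrightarrow> of_gen s * x \<le> of_gen s * w"
  using bruhat_lifting less_mult_gen by (meson order.strict_implies_order order.trans)

lemma bruhat_lifting_down: "ldesc s w \<Longrightarrow> x \<le> w \<Longrightarrow> of_gen s * x \<le> w"
  using bruhat_lifting mult_gen_less by (meson order.strict_implies_order order.trans)

lemma one_le_weyl: "1 \<le> (w :: weyl)"
  by (induction w rule: weyl_left_induct)
    (auto dest: less_mult_gen intro: order.trans order.strict_implies_order)

text \<open>The group contains a nontrivial translation.\<close>

lemma infinite_weyl: "infinite (UNIV :: weyl set)"
proof
  assume fin: "finite (UNIV :: weyl set)"
  let ?g = "word_val [S0, S2, S0, S1, S2, S1]"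
  have tr: "action (?g ^ n) (x, y) = (x + 6 * int n, y + 6 * int n)" for n x y
    by (induction n) (simp_all add: algebra_simps)
  have "inj (\<lambda>n. ?g ^ n)"
  proof (rule injI)
    fix m n assume "?g ^ m = ?g ^ n"
    then have "action (?g ^ m) (0, 0) = action (?g ^ n) (0, 0)" by simp
    then show "m = n" unfolding tr by simp
  qed
  then show False using finite_subset[OF subset_UNIV fin] finite_imageD by blast
qed

text \<open>An element with all generators as left descents lies above the whole group, by the
  lifting property applied letter by letter. But only finitely many elements lie below a given
  one, and the group is infinite.\<close>

lemma not_all_ldesc: "\<exists>s. \<not> ldesc s z"
proof (rule ccontr)
  assume "\<not> ?thesis"
  then have all: "ldesc s z" for s by blast
  have "x \<le> z" for x
    by (induction x rule: weyl_left_induct) (auto intro: one_le_weyl bruhat_lifting_down all)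
  then have "UNIV \<subseteq> insert z {x. x < z}" by (auto simp: order.order_iff_strict)
  moreover have "finite (insert z {x. x < z})" using finite_bruhat_below by simp
  ultimately show False using infinite_weyl finite_subset by blast
qed

section \<open>Dihedral factors and Matsumoto's theorem\<close>

fun braid_word :: "gen \<Rightarrow> gen \<Rightarrow> gen list" where
  "braid_word S0 S1 = [S0, S1]"
| "braid_word S1 S0 = [S1, S0]"
| "braid_word s t = [s, t, s, t]"

lemma word_val_braid_word: "word_val (braid_word s t) = word_val (braid_word t s)"
  by (cases s; cases t) (auto simp del: weyl_cancel simp: weyl_braid)

text \<open>If \<open>t\<close> is a left descent of a reduced product \<open>u w'\<close> but not of
  \<open>u\<close>, the exchange condition deletes a letter of \<open>w'\<close>, so
  \<open>u\<close> can be extended to \<open>t u\<close> inside a reduced factorization.\<close>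

lemma extract_ldesc:
  assumes "\<not> inversion u (of_gen t)" "inversion (u * w') (of_gen t)"
    "len (u * w') = len u + len w'"
  shows "\<exists>w''. u * w' = of_gen t * u * w'' \<and> len (of_gen t * u) = Suc (len u) \<and>
    len (of_gen t * u * w'') = len (of_gen t * u) + len w''"
proof -
  define r where "r = inverse u * of_gen t * u"
  have eq: "of_gen t * u * (r * w') = u * w'" by (simp add: r_def mult.assoc)
  have "inversion w' r" using assms(1,2) by (simp add: inversion_mult r_def)
  then have "len (r * w') < len w'" by (rule inversion_len_less)
  moreover have 1: "len (of_gen t * u) = Suc (len u)"
    using assms(1) by (simp add: len_mult_gen ldesc_def)
  moreover have "len (u * w') \<le> len (of_gen t * u) + len (r * w')"
    using len_mult_le[of "of_gen t * u" "r * w'"] eq by simp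
  ultimately have "len (of_gen t * u * (r * w')) = len (of_gen t * u) + len (r * w')"
    using assms(3) eq by simp
  then show ?thesis using 1 eq by metis
qed

text \<open>The alternating words that are shorter than the braid relation have only their first letter
  as a left descent. This holds because the products of two generators do not have smaller orders
  than the relators say, which the affine action certifies.\<close>

lemma alternating_not_inversion:
  assumes "s \<noteq> t"
  shows "\<not> inversion (of_gen t) (of_gen s)"
    "{s, t} \<noteq> {S0, S1} \<Longrightarrow> \<not> inversion (of_gen s * of_gen t) (of_gen t)"
    "{s, t} \<noteq> {S0, S1} \<Longrightarrow> \<not> inversion (of_gen t * (of_gen s * of_gen t)) (of_gen s)"
proof -
  show "\<not> inversion (of_gen t) (of_gen s)" using assms by simp
  show "\<not> inversion (of_gen s * of_gen t) (of_gen t)" if "{s, t} \<noteq> {S0, S1}"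
    using not_ldesc_word[of t 1 "[s, t]"] assms that
    by (cases s; cases t) (auto simp: ldesc_def le_Suc_eq)
  show "\<not> inversion (of_gen t * (of_gen s * of_gen t)) (of_gen s)" if "{s, t} \<noteq> {S0, S1}"
    using not_ldesc_word[of s 1 "[t, s, t]"] assms that
    by (cases s; cases t) (auto simp: ldesc_def le_Suc_eq)
qed

text \<open>Starting from the letter \<open>t\<close>, the descents \<open>s\<close> and
  \<open>t\<close> are extracted alternately until a full side of the braid relation has been
  split off.\<close>

lemma dihedral_factor:
  assumes "s \<noteq> t" "ldesc s w" "ldesc t w"
  shows "\<exists>w'. w = word_val (braid_word s t) * w' \<and> len w = length (braid_word s t) + len w'"
proof -
  note desc = assms(2,3)[unfolded ldesc_def]
  have t1: "len (of_gen t) = 1" for t using len_mult_gen[of t 1] by (simp add: ldesc_def)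
  define w1 where "w1 = of_gen t * w"
  have w1: "w = of_gen t * w1" by (simp add: w1_def)
  have l1: "len (of_gen t * w1) = len (of_gen t) + len w1"
    using assms(3) len_mult_gen[of t w] by (simp add: t1 w1_def)
  obtain w2 where w2: "w = of_gen s * of_gen t * w2"
    "len (of_gen s * of_gen t * w2) = len (of_gen s * of_gen t) + len w2"
    "len (of_gen s * of_gen t) = 2"
    using extract_ldesc[OF alternating_not_inversion(1)[OF assms(1)] _ l1] desc w1 t1 by auto
  show ?thesis
  proof (cases "{s, t} = {S0, S1}")
    case True
    then have "braid_word s t = [s, t]" by (auto simp: doubleton_eq_iff)
    then show ?thesis using w2 by (intro exI[of _ w2]) (simp add: mult.assoc)
  next
    case False
    then have "braid_word s t = [s, t, s, t]" by (cases s; cases t) auto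
    moreover obtain w3 where w3: "w = of_gen t * (of_gen s * of_gen t) * w3"
      "len (of_gen t * (of_gen s * of_gen t) * w3) = len (of_gen t * (of_gen s * of_gen t)) + len w3"
      "len (of_gen t * (of_gen s * of_gen t)) = 3"
      using extract_ldesc[OF alternating_not_inversion(2)[OF assms(1) False] _ w2(2)] desc w2(1,3)
      by auto
    moreover obtain w4 where "w = of_gen s * (of_gen t * (of_gen s * of_gen t)) * w4"
      "len (of_gen s * (of_gen t * (of_gen s * of_gen t)) * w4) =
        len (of_gen s * (of_gen t * (of_gen s * of_gen t))) + len w4"
      "len (of_gen s * (of_gen t * (of_gen s * of_gen t))) = 4"
      using extract_ldesc[OF alternating_not_inversion(3)[OF assms(1) False] _ w3(2)] desc w3(1,3)
      by auto
    ultimately show ?thesis by (intro exI[of _ w4]) (simp add: mult.assoc)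
  qed
qed

lemma reduced_Cons:
  assumes "reduced_expr (s # us) w"
  shows "ldesc s w" "reduced_expr us (of_gen s * w)"
proof -
  have *: "of_gen s * w = word_val us" "Suc (length us) = len w"
    using assms by (auto simp: reduced_expr_def)
  then have "len (of_gen s * w) < len w" using len_word_val_le[of us] by simp
  then show "ldesc s w" using len_mult_gen(1)[of s w] by (simp split: if_splits)
  then show "reduced_expr us (of_gen s * w)"
    using * len_mult_gen(1)[of s w] by (simp add: reduced_expr_def)
qed

lemma reduced_ConsI: "\<not> ldesc s w \<Longrightarrow> reduced_expr us w \<Longrightarrow> reduced_expr (s # us) (of_gen s * w)"
  by (auto simp: reduced_expr_def len_mult_gen)

text \<open>Two reduced expressions that begin with different letters \<open>s\<close> and
  \<open>t\<close> are compared with reduced expressions that begin with the two sides of the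
  braid relation of \<open>s\<close> and \<open>t\<close>; these share their first letter with one
  of the given expressions each, and agree with each other after one braid move.\<close>

theorem matsumoto:
  fixes T :: "gen \<Rightarrow> 'a :: monoid_mult"
  assumes braid: "\<And>s t. prod_list (map T (braid_word s t)) = prod_list (map T (braid_word t s))"
    and "reduced_expr us w" "reduced_expr vs w"
  shows "prod_list (map T us) = prod_list (map T vs)"
  using assms(2,3)
proof (induction "length us" arbitrary: us vs w)
  case 0
  then show ?case by (auto simp: reduced_expr_def)
next
  case (Suc n)
  have "length vs = Suc n" using Suc by (simp add: reduced_expr_def)
  with Suc(2) obtain s us' t vs' where eq: "us = s # us'" "vs = t # vs'"
    by (metis length_Suc_conv)
  note us = Suc(3)[unfolded eq] and vs = Suc(4)[unfolded eq]
  have n: "n = length us'" "n = length vs'"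
    using Suc(2) \<open>length vs = Suc n\<close> eq by auto
  show ?case
  proof (cases "s = t")
    case True
    then show ?thesis
      using Suc(1)[OF n(1) reduced_Cons(2)[OF us]] reduced_Cons(2)[OF vs] eq by auto
  next
    case False
    obtain w' where w': "w = word_val (braid_word s t) * w'"
      "len w = length (braid_word s t) + len w'"
      using dihedral_factor[OF False reduced_Cons(1)[OF us] reduced_Cons(1)[OF vs]] by blast
    obtain rs where rs: "reduced_expr rs w'" using reduced_expr_exists by blast
    obtain bs where bs: "braid_word s t = s # bs" by (cases s; cases t) auto
    obtain bs' where bs': "braid_word t s = t # bs'" by (cases s; cases t) auto
    have len: "length (braid_word s t) = length (braid_word t s)" by (cases s; cases t) auto
    have "reduced_expr (s # bs @ rs) w"
      using w' rs bs by (simp add: reduced_expr_def mult.assoc)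
    from Suc(1)[OF n(1) reduced_Cons(2)[OF us] reduced_Cons(2)[OF this]]
    have 1: "prod_list (map T us) = prod_list (map T (braid_word s t)) * prod_list (map T rs)"
      by (simp add: eq bs mult.assoc)
    have "reduced_expr (t # bs' @ rs) w"
      using w' rs bs' word_val_braid_word[of s t] len by (simp add: reduced_expr_def mult.assoc)
    from Suc(1)[OF n(2) reduced_Cons(2)[OF vs] reduced_Cons(2)[OF this]]
    have 2: "prod_list (map T vs) = prod_list (map T (braid_word t s)) * prod_list (map T rs)"
      by (simp add: eq bs' mult.assoc)
    show ?thesis using 1 2 braid by simp
  qed
qed

section \<open>The standard basis of the Hecke algebra\<close>

lemma scal_simps [simp]: "scal 0 = 0" "scal 1 = 1"
  by (simp_all add: zero_hecke_def one_hecke_def scal_def)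

lemma scal_add: "scal (a + b) = scal a + scal b"
  by transfer (rule hecke_eq.scal_plus)

lemma scal_mult: "scal (a * b) = scal a * scal b"
  by transfer (rule hecke_eq.scal_times)

lemma scal_uminus: "scal (- a) = - scal a"
  using scal_add[of a "- a"] by (simp add: eq_neg_iff_add_eq_0 add.commute)

lemma scal_diff: "scal (a - b) = scal a - scal b"
  using scal_add[of a "- b"] by (simp add: scal_uminus)

lemma scal_commute: "x * scal a = scal a * x"
  by transfer (rule hecke_eq.sym, rule hecke_eq.scal_central)

lemma scal_left_commute: "x * (scal a * y) = scal a * (x * y)"
  by (metis mult.assoc scal_commute)

lemma Hgen_square: "Hgen s * Hgen s = scal (vinv - vv) * Hgen s + 1"
  by transfer (rule hecke_eq.quadratic)

lemma Hgen_braid: "prod_list (map Hgen (braid_word s t)) = prod_list (map Hgen (braid_word t s))"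
proof -
  have "Hgen S1 * (Hgen S2 * (Hgen S1 * Hgen S2)) = Hgen S2 * (Hgen S1 * (Hgen S2 * Hgen S1))"
    by transfer (rule hecke_eq.braid_12)
  moreover have "Hgen S2 * (Hgen S0 * (Hgen S2 * Hgen S0)) = Hgen S0 * (Hgen S2 * (Hgen S0 * Hgen S2))"
    by transfer (rule hecke_eq.braid_20)
  moreover have "Hgen S1 * Hgen S0 = Hgen S0 * Hgen S1"
    by transfer (rule hecke_eq.braid_10)
  ultimately show ?thesis by (cases s; cases t) simp_all
qed

lemma hecke_induct [case_names scal gen plus times]:
  assumes "\<And>a. P (scal a)" "\<And>s. P (Hgen s)" "\<And>x y. P x \<Longrightarrow> P y \<Longrightarrow> P (x + y)"
    "\<And>x y. P x \<Longrightarrow> P y \<Longrightarrow> P (x * y)"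
  shows "P h"
proof -
  have "P (abs_hecke e)" for e
    by (induction e)
      (use assms in \<open>auto simp flip: scal.abs_eq Hgen.abs_eq plus_hecke.abs_eq times_hecke.abs_eq\<close>)
  then show ?thesis by (rule hecke.abs_induct)
qed

lemma Hstd_reduced: "reduced_expr us w \<Longrightarrow> Hstd w = prod_list (map Hgen us)"
  unfolding Hstd_def by (rule matsumoto[OF Hgen_braid someI])

lemma Hstd_one [simp]: "Hstd 1 = 1"
  using Hstd_reduced[of "[]" 1] by (simp add: reduced_expr_def)

lemma Hgen_Hstd_up: "\<not> ldesc s w \<Longrightarrow> Hgen s * Hstd w = Hstd (of_gen s * w)"
  using reduced_expr_exists[of w] Hstd_reduced reduced_ConsI by fastforce

lemma Hgen_Hstd:
  "Hgen s * Hstd w = Hstd (of_gen s * w) + (if ldesc s w then scal (vinv - vv) * Hstd w else 0)"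
proof (cases "ldesc s w")
  case True
  then have *: "Hstd w = Hgen s * Hstd (of_gen s * w)"
    using Hgen_Hstd_up[of s "of_gen s * w"] by simp
  have "Hgen s * Hstd w = Hgen s * Hgen s * Hstd (of_gen s * w)"
    by (simp add: * mult.assoc)
  also have "\<dots> = scal (vinv - vv) * (Hgen s * Hstd (of_gen s * w)) + Hstd (of_gen s * w)"
    by (simp add: Hgen_square ring_distribs mult.assoc)
  finally show ?thesis using True by (simp add: * add.commute)
qed (simp add: Hgen_Hstd_up)

text \<open>If \<open>f\<close> gives the coefficients of an element of the Hecke algebra in the
  standard basis, then \<open>Lop s f\<close> and \<open>Rop t f\<close> give those of its product
  with a generator on the left and on the right. The operators make sense on arbitrary functions,
  and the braid relations for the \<open>Lop s\<close> follow from the fact that they commute with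
  the \<open>Rop t\<close>.\<close>

definition Lop :: "gen \<Rightarrow> (weyl \<Rightarrow> laurent) \<Rightarrow> weyl \<Rightarrow> laurent" where
  "Lop s f w = f (of_gen s * w) + (if ldesc s w then (vinv - vv) * f w else 0)"

definition Rop :: "gen \<Rightarrow> (weyl \<Rightarrow> laurent) \<Rightarrow> weyl \<Rightarrow> laurent" where
  "Rop t f w = f (w * of_gen t) + (if ldesc t (inverse w) then (vinv - vv) * f w else 0)"

text \<open>If \<open>s w \<noteq> w t\<close>, multiplication by \<open>t\<close> on the right does
  not change whether \<open>s\<close> is a left descent, and symmetrically. If \<open>s w = w
  t\<close>, both operators act as the same two-dimensional matrix on the values at
  \<open>w\<close> and \<open>s w\<close>.\<close>

lemma Lop_Rop: "Lop s (Rop t f) = Rop t (Lop s f)"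
proof
  fix w
  let ?s = "of_gen s" and ?t = "of_gen t"
  show "Lop s (Rop t f) w = Rop t (Lop s f) w"
  proof (cases "?s * w = w * ?t")
    case True
    have 1: "inverse (?s * w) = ?t * inverse w"
      by (metis True inverse_mult_weyl inverse_of_gen)
    have 2: "?s * w * ?t = w" by (simp only: True mult.assoc of_gen_square mult.right_neutral)
    have 3: "ldesc t (inverse w) \<longleftrightarrow> ldesc s w"
      unfolding ldesc_def inversion_inverse
      by (metis True mult.assoc mult.right_neutral weyl_right_inverse)
    show ?thesis
      unfolding Lop_def Rop_def 1 2 True[symmetric] ldesc_mult_self weyl_cancel 3
      by (simp add: distrib_left)
  next
    case False
    have "inverse w * (?s * w) \<noteq> ?t"
      using False by (metis weyl_cancel(2))
    then have 1: "ldesc s (w * ?t) \<longleftrightarrow> ldesc s w"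
      by (auto simp: ldesc_def inversion_mult mult.assoc)
    have "w * (?t * inverse w) \<noteq> ?s"
      using False by (metis mult.assoc mult.right_neutral weyl_left_inverse)
    then have 2: "ldesc t (inverse w * ?s) \<longleftrightarrow> ldesc t (inverse w)"
      by (auto simp: ldesc_def inversion_mult mult.assoc)
    show ?thesis using 1 2 by (simp add: Lop_def Rop_def inverse_mult_weyl algebra_simps)
  qed
qed

lemma weyl_right_induct [case_names one mult]:
  assumes "P 1" "\<And>t w. \<not> ldesc t (inverse w) \<Longrightarrow> P w \<Longrightarrow> P (w * of_gen t)"
  shows "P w"
proof -
  have "P (inverse w)" for w
  proof (induction w rule: weyl_left_induct)
    case (mult s w)
    then show ?case using assms(2)[of s "inverse w"] by (simp add: inverse_mult_weyl)
  qed (simp add: assms)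
  from this[of "inverse w"] show ?thesis by simp
qed

text \<open>The operators \<open>Rop t\<close> transport the value at \<open>1\<close> to any other
  point, so an operator that commutes with them is determined by its values at
  \<open>1\<close>.\<close>

lemma eq_if_commute_Rop:
  assumes "\<And>t f. A (Rop t f) = Rop t (A f)" "\<And>t f. B (Rop t f) = Rop t (B f)"
    "\<And>f. A f 1 = B f 1"
  shows "A f = (B f :: weyl \<Rightarrow> laurent)"
proof
  fix w show "A f w = B f w"
  proof (induction w arbitrary: f rule: weyl_right_induct)
    case (mult t w)
    have "Rop t g w = g (w * of_gen t)" for g using mult(1) by (simp add: Rop_def)
    then have "A f (w * of_gen t) = A (Rop t f) w" "B f (w * of_gen t) = B (Rop t f) w"
      by (simp_all only: assms(1,2))
    then show ?case using mult(2) by simp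
  qed (rule assms)
qed

lemma Lop_not_ldesc: "\<not> inversion w (of_gen s) \<Longrightarrow> Lop s f w = f (of_gen s * w)"
  by (simp add: Lop_def ldesc_def)

text \<open>At \<open>1\<close>, each side only evaluates \<open>f\<close> at the longest element of
  a dihedral subgroup, because the alternating words on the way there are reduced.\<close>

lemma Lop_braid:
  "Lop S1 (Lop S0 f) = Lop S0 (Lop S1 f)"
  "s \<noteq> t \<Longrightarrow> {s, t} \<noteq> {S0, S1} \<Longrightarrow>
    Lop s (Lop t (Lop s (Lop t f))) = Lop t (Lop s (Lop t (Lop s f)))"
proof -
  show "Lop S1 (Lop S0 f) = Lop S0 (Lop S1 f)"
    by (rule eq_if_commute_Rop[where f = f])
      (simp_all add: Lop_Rop Lop_not_ldesc weyl_braid del: weyl_cancel)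
  show "Lop s (Lop t (Lop s (Lop t f))) = Lop t (Lop s (Lop t (Lop s f)))"
    if st: "s \<noteq> t" "{s, t} \<noteq> {S0, S1}"
  proof (rule eq_if_commute_Rop[where f = f])
    have *: "Lop s (Lop t (Lop s (Lop t f))) 1 = f (of_gen t * (of_gen s * (of_gen t * of_gen s)))"
      if "s \<noteq> t" "{s, t} \<noteq> {S0, S1}" for s t f
      using alternating_not_inversion[of t s] that
      by (simp add: Lop_not_ldesc insert_commute)
    have "of_gen t * (of_gen s * (of_gen t * of_gen s)) = of_gen s * (of_gen t * (of_gen s * of_gen t))"
      using word_val_braid_word[of s t] st by (cases s; cases t) auto
    then show "Lop s (Lop t (Lop s (Lop t f))) 1 = Lop t (Lop s (Lop t (Lop s f))) 1" for f
      using *[OF st, of f] *[of t s f] st by (simp add: insert_commute)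
  qed (simp_all add: Lop_Rop)
qed

lemma Lop_square: "Lop s (Lop s f) w = (vinv - vv) * Lop s f w + f w"
  by (simp add: Lop_def algebra_simps)

primrec regular :: "hexp \<Rightarrow> (weyl \<Rightarrow> laurent) \<Rightarrow> weyl \<Rightarrow> laurent" where
  "regular (Scal a) f = (\<lambda>w. a * f w)"
| "regular (Gen s) f = Lop s f"
| "regular (Plus x y) f = (\<lambda>w. regular x f w + regular y f w)"
| "regular (Times x y) f = regular x (regular y f)"

lemma regular_linear:
  "regular x (\<lambda>w. f w + g w) = (\<lambda>w. regular x f w + regular x g w)"
  "regular x (\<lambda>w. a * f w) = (\<lambda>w. a * regular x f w)"
  "regular x (\<lambda>w. 0) = (\<lambda>w. 0)"
proof (induction x arbitrary: f g)
  case (Gen s)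
  case 1 show ?case by (simp add: Lop_def fun_eq_iff algebra_simps)
  case 2 show ?case by (simp add: Lop_def fun_eq_iff algebra_simps)
  case 3 show ?case by (simp add: Lop_def fun_eq_iff)
qed (simp_all add: algebra_simps)

lemma regular_cong: "hecke_eq x y \<Longrightarrow> regular x = regular y"
proof (induction rule: hecke_eq.induct)
  case braid_12
  then show ?case by (simp add: fun_eq_iff Lop_braid(2)[of S1 S2] doubleton_eq_iff)
next
  case braid_20
  then show ?case by (simp add: fun_eq_iff Lop_braid(2)[of S2 S0] doubleton_eq_iff)
next
  case (times_cong x x' y y')
  then show ?case by (intro ext) simp
next
  case braid_10
  then show ?case by (simp add: fun_eq_iff Lop_braid(1))
qed (auto simp: fun_eq_iff algebra_simps regular_linear Lop_square)

text \<open>The action of \<open>h\<close> on the basis vector of \<open>1\<close>. This recovers the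
  coefficients of \<open>h\<close> in the standard basis and thereby shows that the standard basis
  is linearly independent.\<close>

lift_definition coef :: "hecke \<Rightarrow> weyl \<Rightarrow> laurent" is
  "\<lambda>h. regular h (\<lambda>w. if w = 1 then 1 else 0)"
  by (simp add: regular_cong)

lemma coef_add [simp]: "coef (x + y) w = coef x w + coef y w"
  by transfer simp

lemma coef_scal_mult [simp]: "coef (scal a * x) w = a * coef x w"
  by transfer simp

lemma coef_one: "coef 1 w = (if w = 1 then 1 else 0)"
  by transfer simp

lemma coef_zero [simp]: "coef 0 w = 0"
  by transfer simp

lemma coef_uminus [simp]: "coef (- x) w = - coef x w"
  using coef_add[of x "- x" w] by (simp add: eq_neg_iff_add_eq_0 add.commute)

lemma coef_diff [simp]: "coef (x - y) w = coef x w - coef y w"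
  using coef_add[of x "- y" w] by simp

lemma coef_sum [simp]: "coef (sum f A) w = (\<Sum>i\<in>A. coef (f i) w)"
  by (induction A rule: infinite_finite_induct) auto

lemma coef_Hgen_mult:
  "coef (Hgen s * x) w = coef x (of_gen s * w) + (if ldesc s w then (vinv - vv) * coef x w else 0)"
  by transfer (simp add: Lop_def)

lemma coef_Hstd: "coef (Hstd w) x = (if x = w then 1 else 0)"
proof (induction w arbitrary: x rule: weyl_left_induct)
  case one
  then show ?case by (simp add: coef_one)
next
  case (mult s w)
  have "of_gen s * x = w \<longleftrightarrow> x = of_gen s * w" by auto
  then show ?case
    using mult by (auto simp: coef_Hgen_mult simp flip: Hgen_Hstd_up)
qed

inductive_set std_span :: "hecke set" where
  zero: "0 \<in> std_span"
| add: "g \<in> std_span \<Longrightarrow> scal a * Hstd w + g \<in> std_span"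

lemma std_span_add: "g \<in> std_span \<Longrightarrow> h \<in> std_span \<Longrightarrow> g + h \<in> std_span"
  by (induction rule: std_span.induct) (auto simp: add.assoc intro: std_span.add)

lemma std_span_scal_Hstd: "scal a * Hstd w \<in> std_span"
  using std_span.add[OF std_span.zero, of a w] by simp

text \<open>The span of the standard basis is a left ideal that contains \<open>1\<close>, hence
  everything.\<close>

lemma std_span_mult: "g \<in> std_span \<Longrightarrow> h * g \<in> std_span"
proof (induction h arbitrary: g rule: hecke_induct)
  case (scal a)
  then show ?case
  proof (induction rule: std_span.induct)
    case (add g b w)
    then show ?case
      by (simp add: ring_distribs std_span.add flip: mult.assoc scal_mult)
  qed (simp add: std_span.zero)
next
  case (gen s)
  then show ?case
  proof (induction rule: std_span.induct)
    case (add g b w)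
    have "Hgen s * (scal b * Hstd w) \<in> std_span"
      unfolding scal_left_commute[of "Hgen s"] Hgen_Hstd ring_distribs
      by (auto simp flip: mult.assoc scal_mult intro!: std_span_add std_span_scal_Hstd std_span.zero)
    then show ?case using add by (simp add: ring_distribs std_span_add)
  qed (simp add: std_span.zero)
qed (simp_all add: ring_distribs std_span_add mult.assoc)

lemma in_std_span: "h \<in> std_span"
  using std_span_mult[OF std_span_scal_Hstd[of 1 1], of h] by simp

text \<open>The statement for all larger finite sets is the one that passes through the induction,
  where the supports of the summands differ.\<close>

lemma coef_expansion_ex:
  "\<exists>F. finite F \<and> (\<forall>F'. finite F' \<and> F \<subseteq> F' \<longrightarrow> h = (\<Sum>x\<in>F'. scal (coef h x) * Hstd x))"
  (is "\<exists>F. ?P F h")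
  using in_std_span[of h]
proof (induction rule: std_span.induct)
  case (add g a w)
  then obtain F where F: "?P F g" by blast
  have "?P (insert w F) (scal a * Hstd w + g)"
  proof (intro conjI allI impI)
    fix F' assume F': "finite F' \<and> insert w F \<subseteq> F'"
    have "(\<Sum>x\<in>F'. scal (coef (scal a * Hstd w + g) x) * Hstd x) =
        (\<Sum>x\<in>F'. (if x = w then scal a * Hstd x else 0) + scal (coef g x) * Hstd x)"
      by (intro sum.cong) (auto simp: coef_Hstd scal_add ring_distribs)
    also have "\<dots> = scal a * Hstd w + g"
      using F F' by (simp add: sum.distrib)
    finally show "scal a * Hstd w + g = (\<Sum>x\<in>F'. scal (coef (scal a * Hstd w + g) x) * Hstd x)" ..
  qed (use F in simp)
  then show ?case by blast
qed (intro exI[of _ "{}"], simp)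

lemma finite_coef: "finite {x. coef h x \<noteq> 0}"
proof -
  obtain F0 where F0: "finite F0"
    "\<And>F'. finite F' \<Longrightarrow> F0 \<subseteq> F' \<Longrightarrow> h = (\<Sum>x\<in>F'. scal (coef h x) * Hstd x)"
    using coef_expansion_ex[of h] by blast
  then have eq: "h = (\<Sum>x\<in>F0. scal (coef h x) * Hstd x)" by blast
  have "coef h x = 0" if "x \<notin> F0" for x
  proof -
    have "coef h x = (\<Sum>y\<in>F0. coef h y * (if x = y then 1 else 0))"
      using arg_cong[OF eq, of "\<lambda>h. coef h x"] by (simp add: coef_Hstd)
    also have "\<dots> = 0" using that by (intro sum.neutral) auto
    finally show ?thesis .
  qed
  then have "{x. coef h x \<noteq> 0} \<subseteq> F0" by blast
  then show ?thesis using F0 finite_subset by blast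
qed

lemma coef_expansion:
  assumes "finite F" "{x. coef h x \<noteq> 0} \<subseteq> F"
  shows "h = (\<Sum>x\<in>F. scal (coef h x) * Hstd x)"
proof -
  obtain F0 where F0: "finite F0"
    "\<And>F'. finite F' \<Longrightarrow> F0 \<subseteq> F' \<Longrightarrow> h = (\<Sum>x\<in>F'. scal (coef h x) * Hstd x)"
    using coef_expansion_ex[of h] by blast
  have "h = (\<Sum>x\<in>F0 \<union> F. scal (coef h x) * Hstd x)" using F0 assms by blast
  also have "\<dots> = (\<Sum>x\<in>F. scal (coef h x) * Hstd x)"
  proof (rule sum.mono_neutral_right)
    show "\<forall>x\<in>(F0 \<union> F) - F. scal (coef h x) * Hstd x = 0"
    proof
      fix x assume "x \<in> (F0 \<union> F) - F"
      then have "coef h x = 0" using assms(2) by blast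
      then show "scal (coef h x) * Hstd x = 0" by simp
    qed
  qed (use F0 assms in auto)
  finally show "h = (\<Sum>x\<in>F. scal (coef h x) * Hstd x)" .
qed

section \<open>The bar involution\<close>

definition lbar :: "laurent \<Rightarrow> laurent" where
  "lbar p = Poly_Mapping.map_key uminus p"

lemma lookup_lbar: "Poly_Mapping.lookup (lbar p) k = Poly_Mapping.lookup p (- k)"
  by (simp add: lbar_def map_key.rep_eq)

lemma lbar_add: "lbar (p + q) = lbar p + lbar q"
  by (rule poly_mapping_eqI) (simp add: lookup_lbar lookup_add)

lemma lbar_diff: "lbar (p - q) = lbar p - lbar q"
  by (rule poly_mapping_eqI) (simp add: lookup_lbar lookup_minus)

lemma lbar_zero [simp]: "lbar 0 = 0"
  by (rule poly_mapping_eqI) (simp add: lookup_lbar)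

lemma lbar_single: "lbar (Poly_Mapping.single k c) = Poly_Mapping.single (- k) c"
  by (rule poly_mapping_eqI) (auto simp add: lookup_lbar lookup_single when_def)

lemma lbar_one [simp]: "lbar 1 = 1"
  using lbar_single[of 0 1] by simp

lemma lbar_vv [simp]: "lbar vv = vinv" "lbar vinv = vv"
  by (simp_all add: vv_def vinv_def lbar_single)

lemma lbar_lbar [simp]: "lbar (lbar p) = p"
  by (rule poly_mapping_eqI) (simp add: lookup_lbar)

lemma laurent_induct [case_names zero one diff]:
  assumes "P 0" "\<And>k. P (Poly_Mapping.single k 1)" "\<And>p q. P p \<Longrightarrow> P q \<Longrightarrow> P (p - q)"
  shows "P (p :: laurent)"
  by (rule frag_induction[of p UNIV]) (use assms in auto)

lemma lbar_mult: "lbar (p * q) = lbar p * lbar q"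
proof (induction p rule: laurent_induct)
  case (one k)
  show ?case
    by (induction q rule: laurent_induct)
      (simp_all add: lbar_single lbar_diff mult_single right_diff_distrib)
qed (simp_all add: lbar_diff left_diff_distrib)

definition Hinv :: "gen \<Rightarrow> hecke" where
  "Hinv s = Hgen s + scal (vv - vinv)"

lemma Hinv_Hgen [simp]: "Hinv s * Hgen s = 1" "Hgen s * Hinv s = 1"
  by (simp_all add: Hinv_def Hgen_square ring_distribs scal_commute[of "Hgen s"] scal_diff)

text \<open>The element \<open>Hinv s\<close> is the inverse of \<open>Hgen s\<close>, so the braid
  relations of the \<open>Hinv s\<close> are the inverses of those of the generators.\<close>

lemma prod_Hinv:
  "prod_list (map Hinv us) * prod_list (map Hgen (rev us)) = 1"
  "prod_list (map Hgen (rev us)) * prod_list (map Hinv us) = 1"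
proof (induction us)
  case (Cons s us)
  case 1
  have "Hinv s * (prod_list (map Hinv us) * prod_list (map Hgen (rev us))) * Hgen s = 1"
    using Cons(1) by simp
  then show ?case by (simp add: mult.assoc)
  case 2
  have "prod_list (map Hgen (rev us)) * (Hgen s * Hinv s) * prod_list (map Hinv us) = 1"
    using Cons(2) by simp
  then show ?case by (simp only: mult.assoc list.map prod_list.Cons rev.simps map_append
      prod_list.append prod_list.Nil mult.right_neutral)
qed simp_all

lemma unique_inverse: "a * x = 1 \<Longrightarrow> x * b = 1 \<Longrightarrow> a = (b :: 'a :: monoid_mult)"
  by (metis mult.assoc mult.left_neutral mult.right_neutral)

lemma Hinv_braid: "prod_list (map Hinv (braid_word s t)) = prod_list (map Hinv (braid_word t s))"
proof -
  have rev: "rev (braid_word s t) = braid_word t s" if "s \<noteq> t" for s t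
    using that by (cases s; cases t) auto
  show ?thesis
  proof (cases "s = t")
    case False
    then show ?thesis
      using prod_Hinv(1)[of "braid_word s t"] prod_Hinv(2)[of "braid_word t s"]
        Hgen_braid[of s t] rev by (metis unique_inverse)
  qed simp
qed

primrec bar_hexp :: "hexp \<Rightarrow> hecke" where
  "bar_hexp (Scal a) = scal (lbar a)"
| "bar_hexp (Gen s) = Hinv s"
| "bar_hexp (Plus x y) = bar_hexp x + bar_hexp y"
| "bar_hexp (Times x y) = bar_hexp x * bar_hexp y"

lemma bar_hexp_cong: "hecke_eq x y \<Longrightarrow> bar_hexp x = bar_hexp y"
proof (induction rule: hecke_eq.induct)
  case (quadratic s)
  have "Hinv s * Hinv s = Hinv s * Hgen s + Hinv s * scal (vv - vinv)"
    by (subst (2) Hinv_def) (simp add: ring_distribs)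
  then show ?case by (simp add: scal_commute[of "Hinv s"] lbar_diff add.commute)
next
  case (scal_central a x)
  show ?case using scal_commute[of "bar_hexp x" "lbar a"] by simp
next
  case braid_12
  then show ?case using Hinv_braid[of S1 S2] by simp
next
  case braid_20
  then show ?case using Hinv_braid[of S2 S0] by simp
next
  case braid_10
  then show ?case using Hinv_braid[of S1 S0] by simp
qed (auto simp: lbar_add lbar_mult scal_add scal_mult ring_distribs mult.assoc add_ac)

lift_definition hbar :: "hecke \<Rightarrow> hecke" is bar_hexp
  by (rule bar_hexp_cong)

lemma hbar_simps:
  "hbar (scal a) = scal (lbar a)" "hbar (Hgen s) = Hinv s"
  "hbar (x + y) = hbar x + hbar y" "hbar (x * y) = hbar x * hbar y"
  by (transfer; simp)+

lemma hbar_one [simp]: "hbar 1 = 1"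
  using hbar_simps(1)[of 1] by simp

lemma hbar_prod_list: "hbar (prod_list (map Hgen us)) = prod_list (map Hinv us)"
  by (induction us) (simp_all add: hbar_simps)

lemma is_bar_involution_hbar: "is_bar_involution hbar"
proof -
  have "hbar (hbar x) = x" for x
  proof (induction x rule: hecke_induct)
    case (gen s)
    have "hbar (Hinv s) = Hinv s + scal (vinv - vv)"
      by (simp add: Hinv_def[of s] hbar_simps lbar_diff)
    then show ?case by (simp add: hbar_simps Hinv_def scal_diff)
  qed (simp_all add: hbar_simps)
  moreover have "hbar (Hstd w) * Hstd (inverse w) = 1 \<and> Hstd (inverse w) * hbar (Hstd w) = 1" for w
  proof -
    obtain us where us: "reduced_expr us w" using reduced_expr_exists by blast
    then have "reduced_expr (rev us) (inverse w)"
      by (simp add: reduced_expr_def word_val_rev)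
    then show ?thesis
      using us prod_Hinv[of us] by (simp add: Hstd_reduced hbar_prod_list)
  qed
  ultimately show ?thesis by (simp add: is_bar_involution_def hbar_simps)
qed

lemma Hstd_of_gen: "Hstd (of_gen s) = Hgen s"
  using Hgen_Hstd_up[of s 1] by (simp add: ldesc_def)

text \<open>The inverses required for the standard basis elements fix the values on generators, and
  the value on \<open>v\<close> fixes those on all scalars.\<close>

lemma bar_involution_unique:
  assumes "is_bar_involution d"
  shows "d = hbar"
proof
  note d = assms[unfolded is_bar_involution_def]
  have add: "d (x + y) = d x + d y" and mult: "d (x * y) = d x * d y" for x y
    using d by blast+
  have zero: "d 0 = 0" using add[of 0 0] by simp
  have uminus: "d (- x) = - d x" for x
    using add[of x "- x"] zero by (simp add: eq_neg_iff_add_eq_0 add.commute)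
  have diff: "d (x - y) = d x - d y" for x y
    using add[of x "- y"] uminus by simp
  have vv: "d (scal vv) = scal vinv" using d by blast
  have "d (scal vinv * scal vv) = 1" "d (scal vv) * scal vv = 1"
    using d vv by (simp_all flip: scal_mult add: vv_vinv)
  then have vinv: "d (scal vinv) = scal vv" unfolding mult by (rule unique_inverse)
  have pos: "d (scal (Poly_Mapping.single (int n) 1)) = scal (Poly_Mapping.single (- int n) 1)" for n
  proof (induction n)
    case (Suc n)
    have "Poly_Mapping.single (int (Suc n)) 1 = vv * Poly_Mapping.single (int n) (1 :: int)"
      "Poly_Mapping.single (- int (Suc n)) 1 = vinv * Poly_Mapping.single (- int n) (1 :: int)"
      by (simp_all add: vv_def vinv_def mult_single)
    then show ?case using Suc by (simp only: scal_mult mult vv)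
  qed (use d in simp)
  have neg: "d (scal (Poly_Mapping.single (- int n) 1)) = scal (Poly_Mapping.single (int n) 1)" for n
  proof (induction n)
    case (Suc n)
    have "Poly_Mapping.single (int (Suc n)) 1 = vv * Poly_Mapping.single (int n) (1 :: int)"
      "Poly_Mapping.single (- int (Suc n)) 1 = vinv * Poly_Mapping.single (- int n) (1 :: int)"
      by (simp_all add: vv_def vinv_def mult_single)
    then show ?case using Suc by (simp only: scal_mult mult vinv)
  qed (use d in simp)
  have scal: "d (scal a) = scal (lbar a)" for a
  proof (induction a rule: laurent_induct)
    case (one k)
    then show ?case
      using pos[of "nat k"] neg[of "nat (- k)"] by (cases "0 \<le> k") (simp_all add: lbar_single)
  qed (simp_all add: zero diff scal_diff lbar_diff)
  have gen: "d (Hgen s) = Hinv s" for s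
  proof (rule unique_inverse)
    have "d (Hstd (of_gen s)) * Hstd (inverse (of_gen s)) = 1" using d by blast
    then show "d (Hgen s) * Hgen s = 1" by (simp add: Hstd_of_gen)
  qed simp
  show "d x = hbar x" for x
    by (induction x rule: hecke_induct) (simp_all add: scal gen add mult hbar_simps)
qed

lemma bar_eq_hbar: "bar = hbar"
  unfolding bar_def
  by (rule the_equality, rule is_bar_involution_hbar, rule bar_involution_unique)

lemmas bar_simps = hbar_simps[folded bar_eq_hbar]

lemma bar_one [simp]: "bar 1 = 1" by (simp add: bar_eq_hbar)

lemma bar_zero [simp]: "bar 0 = 0"
  using bar_simps(1)[of 0] by simp

lemma bar_diff: "bar (x - y) = bar x - bar y"
  using bar_simps(3)[of "x - y" y] by simp

lemma bar_sum: "bar (sum f A) = (\<Sum>i\<in>A. bar (f i))"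
  by (induction A rule: infinite_finite_induct) (auto simp: bar_simps)

text \<open>Unitriangularity with respect to length: the inverse of a generator differs from the
  generator by a scalar, which only contributes shorter terms.\<close>

lemma coef_bar_Hstd:
  "coef (bar (Hstd w)) w = 1 \<and> (\<forall>x. coef (bar (Hstd w)) x \<noteq> 0 \<longrightarrow> x = w \<or> len x < len w)"
proof (induction w rule: weyl_left_induct)
  case one
  then show ?case by (simp add: coef_one)
next
  case (mult s w)
  let ?c = "coef (bar (Hstd w))"
  have len: "len (of_gen s * w) = Suc (len w)" using mult(1) by (simp add: len_mult_gen)
  have "bar (Hstd (of_gen s * w)) = (Hgen s + scal (vv - vinv)) * bar (Hstd w)"
    by (simp add: bar_simps Hinv_def flip: Hgen_Hstd_up[OF mult(1)])
  then have coef: "coef (bar (Hstd (of_gen s * w))) x =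
      ?c (of_gen s * x) + (if ldesc s x then 0 else (vv - vinv) * ?c x)" for x
    by (simp add: ring_distribs coef_Hgen_mult)
  show ?case
  proof (intro conjI allI impI)
    show "coef (bar (Hstd (of_gen s * w))) (of_gen s * w) = 1"
      using mult by (simp add: coef)
    fix x assume "coef (bar (Hstd (of_gen s * w))) x \<noteq> 0"
    then have "?c (of_gen s * x) \<noteq> 0 \<or> ?c x \<noteq> 0" by (auto simp: coef split: if_splits)
    then consider "of_gen s * x = w" | "len (of_gen s * x) < len w" | "len x \<le> len w"
      using mult(2) by force
    then show "x = of_gen s * w \<or> len x < len (of_gen s * w)"
    proof cases
      case 1
      then show ?thesis by auto
    next
      case 2
      then show ?thesis using len len_mult_gen[of s x] by (intro disjI2) (auto split: if_splits)
    qed (use len in simp)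
  qed
qed

lemma v_Zv_iff: "p \<in> v_Zv \<longleftrightarrow> (\<forall>k\<le>0. Poly_Mapping.lookup p k = 0)"
  unfolding v_Zv_def mem_Collect_eq Ball_def in_keys_iff by (meson not_le)

text \<open>By unitriangularity the coefficient at an element of maximal length in the support is
  itself invariant under \<open>v \<mapsto> v\<inverse>\<close>, but a nonzero polynomial without
  constant term is not.\<close>

lemma bar_invariant_zero:
  assumes bar: "bar h = h" and pos: "\<And>x. coef h x \<in> v_Zv"
  shows "h = 0"
proof (rule ccontr)
  assume "h \<noteq> 0"
  let ?F = "{x. coef h x \<noteq> 0}"
  have fin: "finite ?F" by (rule finite_coef)
  have h: "h = (\<Sum>x\<in>?F. scal (coef h x) * Hstd x)" by (rule coef_expansion[OF fin order_refl])
  with \<open>h \<noteq> 0\<close> have "?F \<noteq> {}" by (metis sum.empty)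
  then obtain w where w: "w \<in> ?F" "\<And>x. x \<in> ?F \<Longrightarrow> len x \<le> len w"
  proof -
    have "Max (len ` ?F) \<in> len ` ?F" using fin \<open>?F \<noteq> {}\<close> by (intro Max_in) auto
    then obtain w where "w \<in> ?F" "len w = Max (len ` ?F)" by auto
    then show thesis using fin by (intro that[of w]) simp_all
  qed
  have "coef h w = coef (bar h) w" by (simp add: bar)
  also have "bar h = (\<Sum>x\<in>?F. scal (lbar (coef h x)) * bar (Hstd x))"
    using arg_cong[OF h, of bar] by (simp add: bar_sum bar_simps)
  also have "coef \<dots> w = (\<Sum>x\<in>?F. lbar (coef h x) * coef (bar (Hstd x)) w)" by simp
  also have "\<dots> = (\<Sum>x\<in>?F. if x = w then lbar (coef h w) else 0)"
  proof (rule sum.cong)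
    fix x assume "x \<in> ?F"
    then have "len x \<le> len w" by (rule w(2))
    then have "coef (bar (Hstd x)) w = 0" if "x \<noteq> w" using coef_bar_Hstd[of x] that by force
    then show "lbar (coef h x) * coef (bar (Hstd x)) w = (if x = w then lbar (coef h w) else 0)"
      using coef_bar_Hstd[of w] by simp
  qed simp
  also have "\<dots> = lbar (coef h w)" using w(1) fin by (subst sum.delta) auto
  finally have eq: "coef h w = lbar (coef h w)" .
  have "Poly_Mapping.lookup (coef h w) k = 0" for k
  proof (cases "k \<le> 0")
    case False
    have "Poly_Mapping.lookup (coef h w) k = Poly_Mapping.lookup (coef h w) (- k)"
      by (subst eq) (simp add: lookup_lbar)
    then show ?thesis using False pos[of w] by (simp add: v_Zv_iff)
  qed (use pos[of w] in \<open>simp add: v_Zv_iff\<close>)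
  then have "coef h w = 0" by (intro poly_mapping_eqI) simp
  then show False using w(1) by simp
qed

section \<open>The Kazhdan-Lusztig basis\<close>

lemma lookup_single_mult:
  "Poly_Mapping.lookup (Poly_Mapping.single j c * p) k = c * Poly_Mapping.lookup (p :: laurent) (k - j)"
proof (induction p rule: laurent_induct)
  case (one i)
  then show ?case by (auto simp: mult_single lookup_single when_def)
qed (simp_all add: right_diff_distrib lookup_minus)

lemma v_Zv_zero [simp]: "0 \<in> v_Zv"
  by (simp add: v_Zv_iff)

lemma v_Zv_add: "p \<in> v_Zv \<Longrightarrow> q \<in> v_Zv \<Longrightarrow> p + q \<in> v_Zv"
  by (simp add: v_Zv_iff lookup_add)

lemma v_Zv_diff: "p \<in> v_Zv \<Longrightarrow> q \<in> v_Zv \<Longrightarrow> p - q \<in> v_Zv"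
  by (simp add: v_Zv_iff lookup_minus)

lemma v_Zv_sum: "(\<And>i. i \<in> A \<Longrightarrow> f i \<in> v_Zv) \<Longrightarrow> sum f A \<in> v_Zv"
  by (induction A rule: infinite_finite_induct) (auto intro: v_Zv_add)

lemma v_Zv_const_mult: "p \<in> v_Zv \<Longrightarrow> Poly_Mapping.single 0 c * p \<in> v_Zv"
  by (simp add: v_Zv_iff lookup_single_mult)

lemma v_Zv_vv_mult: "p \<in> v_Zv \<Longrightarrow> vv * p \<in> v_Zv"
  by (simp add: v_Zv_iff lookup_single_mult vv_def)

lemma vv_in_v_Zv: "vv \<in> v_Zv"
  by (simp add: v_Zv_iff vv_def lookup_single when_def)

text \<open>Dividing by \<open>v\<close> turns the coefficient of \<open>v\<close> into a constant
  term. This is the only way in which multiplying by a Kazhdan-Lusztig generator can leave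
  \<open>v \<int>[v]\<close> below the leading term.\<close>

lemma v_Zv_vinv_mult:
  "p \<in> v_Zv \<Longrightarrow> vinv * p - Poly_Mapping.single 0 (Poly_Mapping.lookup p 1) \<in> v_Zv"
  by (auto simp: v_Zv_iff lookup_single_mult vinv_def lookup_minus lookup_single when_def)

text \<open>The coefficient functions replace the explicit sums, and membership becomes a pointwise
  condition.\<close>

lemma is_KL_iff:
  "is_KL w h \<longleftrightarrow> bar h = h \<and> coef h w = 1 \<and> (\<forall>x. x \<noteq> w \<longrightarrow> coef h x \<in> v_Zv) \<and>
    (\<forall>x. coef h x \<noteq> 0 \<longrightarrow> x \<le> w)" (is "?l \<longleftrightarrow> ?r")
proof
  assume ?l
  then obtain p where p: "bar h = h" "\<And>x. p x \<in> v_Zv"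
    "h = Hstd w + (\<Sum>x | x < w. scal (p x) * Hstd x)"
    by (auto simp: is_KL_def)
  have "coef h x = (if x = w then 1 else if x < w then p x else 0)" for x
  proof -
    have "coef h x = (if x = w then 1 else 0) + (\<Sum>y | y < w. p y * (if x = y then 1 else 0))"
      by (subst p(3)) (simp only: coef_add coef_sum coef_scal_mult coef_Hstd)
    also have "(\<Sum>y | y < w. p y * (if x = y then 1 else 0)) = (\<Sum>y | y < w. if y = x then p x else 0)"
      by (intro sum.cong) auto
    also have "\<dots> = (if x < w then p x else 0)"
      using finite_bruhat_below[of w] by simp
    finally show ?thesis by auto
  qed
  then show ?r using p(1,2) by auto
next
  assume r: ?r
  let ?p = "\<lambda>x. if x = w then 0 else coef h x"
  have "h = (\<Sum>x\<in>insert w {x. x < w}. scal (coef h x) * Hstd x)"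
    using r finite_bruhat_below[of w] by (intro coef_expansion) (auto simp: order.order_iff_strict)
  also have "\<dots> = Hstd w + (\<Sum>x | x < w. scal (?p x) * Hstd x)"
    using r finite_bruhat_below[of w] by (auto intro!: sum.cong)
  finally have "h = Hstd w + (\<Sum>x | x < w. scal (?p x) * Hstd x)" .
  moreover have "\<forall>x. ?p x \<in> v_Zv" using r by simp
  ultimately show ?l using r unfolding is_KL_def by (intro conjI exI[of _ ?p]) simp_all
qed

lemma is_KL_unique:
  assumes "is_KL w g" "is_KL w h"
  shows "g = h"
proof -
  have "coef (g - h) x \<in> v_Zv" for x
    using assms by (cases "x = w") (auto simp: is_KL_iff intro: v_Zv_diff)
  then have "g - h = 0"
    using assms by (intro bar_invariant_zero) (simp_all add: bar_diff is_KL_iff)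
  then show ?thesis by simp
qed

lemma KL_eqI: "is_KL w h \<Longrightarrow> KL w = h"
  unfolding KL_def using is_KL_unique by blast

definition Hbar_gen :: "gen \<Rightarrow> hecke" where
  "Hbar_gen s = Hgen s + scal vv"

lemma bar_Hbar_gen: "bar (Hbar_gen s) = Hbar_gen s"
  by (simp add: Hbar_gen_def bar_simps Hinv_def scal_diff)

lemma coef_Hbar_gen_mult:
  "coef (Hbar_gen s * h) x = coef h (of_gen s * x) + (if ldesc s x then vinv else vv) * coef h x"
  by (simp add: Hbar_gen_def ring_distribs coef_Hgen_mult)

lemma Hbar_gen_square: "Hbar_gen s * Hbar_gen s = scal (vv + vinv) * Hbar_gen s"
  by (simp add: Hbar_gen_def ring_distribs Hgen_square scal_commute[of "Hgen s"] scal_diff scal_add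
    vv_vinv flip: scal_mult)

text \<open>The Kazhdan-Lusztig mu-coefficient: in this normalization it is the coefficient of
  \<open>v\<close>.\<close>

abbreviation KL_mu :: "weyl \<Rightarrow> weyl \<Rightarrow> int" where
  "KL_mu z w \<equiv> Poly_Mapping.lookup (coef (KL w) z) 1"

text \<open>The product is bar-invariant, and its coefficients off the leading term lie in \<open>v
  \<int>[v]\<close> except for the constant terms \<open>KL_mu z u\<close> at those \<open>z <
  u\<close> that have the left descent \<open>s\<close>. Subtracting integer multiples of the
  smaller basis elements removes these constants and keeps invariance.\<close>

lemma is_KL_mult_gen:
  assumes desc: "\<not> ldesc s u" and ex: "\<And>z. z \<le> u \<Longrightarrow> is_KL z (KL z)"
  shows "is_KL (of_gen s * u) (Hbar_gen s * KL u -
    (\<Sum>z | z < u \<and> ldesc s z. scal (Poly_Mapping.single 0 (KL_mu z u)) * KL z))"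
    (is "is_KL ?w ?h")
proof -
  let ?M = "{z. z < u \<and> ldesc s z}" and ?c = "coef (KL u)"
  let ?m = "\<lambda>z. Poly_Mapping.single 0 (KL_mu z u) :: laurent"
  have fin: "finite ?M" using finite_bruhat_below[of u] by (rule rev_finite_subset) auto
  have uw: "u < ?w" by (rule less_mult_gen[OF desc])
  have u: "bar (KL u) = KL u" "?c u = 1" "\<And>x. x \<noteq> u \<Longrightarrow> ?c x \<in> v_Zv" "\<And>x. ?c x \<noteq> 0 \<Longrightarrow> x \<le> u"
    using ex[of u] by (auto simp: is_KL_iff)
  have z: "bar (KL z) = KL z" "coef (KL z) z = 1" "\<And>x. x \<noteq> z \<Longrightarrow> coef (KL z) x \<in> v_Zv"
    "\<And>x. coef (KL z) x \<noteq> 0 \<Longrightarrow> x \<le> z" if "z \<in> ?M" for z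
    using ex[of z] that by (auto simp: is_KL_iff)
  have coef: "coef ?h x = ?c (of_gen s * x) + (if ldesc s x then vinv else vv) * ?c x
      - (\<Sum>z\<in>?M. ?m z * coef (KL z) x)" for x
    by (simp add: coef_Hbar_gen_mult)
  show ?thesis unfolding is_KL_iff
  proof (intro conjI allI impI)
    have "bar (scal (?m z) * KL z) = scal (?m z) * KL z" if "z \<in> ?M" for z
      using z(1)[OF that] by (simp add: bar_simps lbar_single)
    then show "bar ?h = ?h"
      by (simp add: bar_diff bar_sum bar_simps(4) bar_Hbar_gen u(1))
    have "coef (KL z) ?w = 0" if "z \<in> ?M" for z
    proof (rule ccontr)
      assume "coef (KL z) ?w \<noteq> 0"
      then have "?w \<le> z" by (rule z(4)[OF that])
      then show False using that uw by auto
    qed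
    moreover have "?c ?w = 0" using u(4)[of ?w] uw unfolding less_le_not_le by blast
    ultimately show "coef ?h ?w = 1" by (simp add: coef_Hbar_gen_mult u(2))
  next
    fix x assume "coef ?h x \<noteq> 0"
    then consider "?c (of_gen s * x) \<noteq> 0" | "?c x \<noteq> 0" | z where "z \<in> ?M" "coef (KL z) x \<noteq> 0"
      unfolding coef by (metis (no_types, lifting) add_0 diff_0_right mult_zero_right sum.neutral)
    then show "x \<le> ?w"
    proof cases
      case 1
      then have "of_gen s * x \<le> u" by (rule u(4))
      from bruhat_lifting_up[OF desc this] show ?thesis by simp
    next
      case 2
      then show ?thesis using u(4)[of x] uw by simp
    next
      case 3
      then show ?thesis using z(4)[of z x] uw by force
    qed
  next
    fix x assume x: "x \<noteq> ?w"
    then have "of_gen s * x \<noteq> u" by auto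
    then have sx: "?c (of_gen s * x) \<in> v_Zv" by (rule u(3))
    have rest: "(\<Sum>z\<in>?M - {x}. ?m z * coef (KL z) x) \<in> v_Zv"
      using z(3) by (intro v_Zv_sum v_Zv_const_mult) auto
    show "coef ?h x \<in> v_Zv"
    proof (cases "x \<in> ?M")
      case True
      have "coef ?h x = ?c (of_gen s * x) + (vinv * ?c x - ?m x)
          - (\<Sum>z\<in>?M - {x}. ?m z * coef (KL z) x)"
        unfolding coef using True z(2)[OF True] by (simp add: sum.remove[OF fin True])
      moreover have "?c x \<in> v_Zv" using True by (intro u(3)) auto
      ultimately show ?thesis
        using sx rest v_Zv_vinv_mult v_Zv_add v_Zv_diff by presburger
    next
      case False
      then have "coef ?h x = ?c (of_gen s * x) + (if ldesc s x then vinv else vv) * ?c x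
          - (\<Sum>z\<in>?M - {x}. ?m z * coef (KL z) x)"
        unfolding coef by simp
      moreover have "(if ldesc s x then vinv else vv) * ?c x \<in> v_Zv"
      proof (cases "ldesc s x")
        case True
        then have "\<not> x \<le> u" using False desc by (auto simp: order.order_iff_strict)
        then have "?c x = 0" using u(4) by blast
        then show ?thesis by simp
      next
        case False
        then show ?thesis
          using u(2) u(3)[of x] by (cases "x = u") (auto simp: vv_in_v_Zv v_Zv_vv_mult)
      qed
      ultimately show ?thesis using sx rest v_Zv_add v_Zv_diff by presburger
    qed
  qed
qed

lemma is_KL_one: "is_KL 1 1"
  by (simp add: is_KL_iff coef_one)

theorem is_KL_KL: "is_KL w (KL w)"
proof (induction "len w" arbitrary: w rule: less_induct)
  case less
  show ?case
  proof (cases "w = 1")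
    case True
    then show ?thesis using is_KL_one KL_eqI by metis
  next
    case False
    then obtain s where s: "ldesc s w" using len_pos_ldesc by blast
    then have "len (of_gen s * w) < len w" using less_weyl_len[OF mult_gen_less] by blast
    then have below: "is_KL z (KL z)" if "z \<le> of_gen s * w" for z
      using less_weyl_len[of z "of_gen s * w"] that
      by (intro less) (auto simp: order.order_iff_strict)
    have "\<not> ldesc s (of_gen s * w)" using s by simp
    from is_KL_mult_gen[OF this below] obtain h where "is_KL w h" by auto
    then show ?thesis using KL_eqI by metis
  qed
qed

theorem KL_mult_gen:
  assumes "\<not> ldesc s u"
  shows "Hbar_gen s * KL u = KL (of_gen s * u) +
    (\<Sum>z | z < u \<and> ldesc s z. scal (Poly_Mapping.single 0 (KL_mu z u)) * KL z)"
  using KL_eqI[OF is_KL_mult_gen[OF assms is_KL_KL]] by simp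

lemma KL_one: "KL 1 = 1"
  by (rule KL_eqI[OF is_KL_one])

lemma KL_of_gen: "KL (of_gen s) = Hbar_gen s"
proof -
  have "{z :: weyl. z < 1 \<and> ldesc s z} = {}" using one_le_weyl by (auto simp: less_weyl_def)
  then show ?thesis using KL_mult_gen[of s 1] by (simp add: ldesc_def KL_one del: Collect_empty_eq)
qed

text \<open>With \<open>w = s u\<close>, the recursion writes \<open>KL w\<close> through
  \<open>Hbar_gen s * KL u\<close> and basis elements \<open>KL z\<close> of shorter
  \<open>z\<close> with left descent \<open>s\<close>. Each of these is an eigenvector: the first
  because \<open>Hbar_gen s\<close> is quasi-idempotent, the others by induction.\<close>

lemma KL_ldesc:
  assumes "ldesc s w"
  shows "Hbar_gen s * KL w = scal (vv + vinv) * KL w"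
  using assms
proof (induction "len w" arbitrary: w rule: less_induct)
  case less
  define u where "u = of_gen s * w"
  have u: "\<not> ldesc s u" "w = of_gen s * u" using less(2) by (simp_all add: u_def)
  have uw: "u < w" using less_mult_gen[OF u(1)] u(2) by simp
  let ?M = "{z. z < u \<and> ldesc s z}"
  let ?m = "\<lambda>z. scal (Poly_Mapping.single 0 (KL_mu z u))"
  have KL: "KL w = Hbar_gen s * KL u - (\<Sum>z\<in>?M. ?m z * KL z)"
    using KL_mult_gen[OF u(1)] u(2) by simp
  have "Hbar_gen s * (?m z * KL z) = scal (vv + vinv) * (?m z * KL z)" if "z \<in> ?M" for z
  proof -
    have "Hbar_gen s * KL z = scal (vv + vinv) * KL z"
      using that uw less_weyl_len[of z w] by (intro less(1)) auto
    then show ?thesis by (simp add: scal_left_commute[of "Hbar_gen s"] scal_left_commute[of "scal (vv + vinv)"])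
  qed
  then have "Hbar_gen s * (\<Sum>z\<in>?M. ?m z * KL z) = scal (vv + vinv) * (\<Sum>z\<in>?M. ?m z * KL z)"
    unfolding sum_distrib_left by (intro sum.cong) simp_all
  moreover have "Hbar_gen s * (Hbar_gen s * KL u) = scal (vv + vinv) * (Hbar_gen s * KL u)"
    using Hbar_gen_square[of s] by (simp flip: mult.assoc)
  ultimately show ?case unfolding KL by (simp add: right_diff_distrib)
qed

lemma coef_KL_ldesc:
  assumes "ldesc s w" "\<not> ldesc s x"
  shows "coef (KL w) x = vv * coef (KL w) (of_gen s * x)"
proof -
  have "coef (KL w) (of_gen s * x) + vv * coef (KL w) x = (vv + vinv) * coef (KL w) x"
    using arg_cong[OF KL_ldesc[OF assms(1)], of "\<lambda>h. coef h x"] assms(2)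
    by (simp add: coef_Hbar_gen_mult)
  then have "coef (KL w) (of_gen s * x) = vinv * coef (KL w) x" by (simp add: algebra_simps)
  then show ?thesis by (simp add: vv_vinv flip: mult.assoc)
qed

text \<open>By \<open>coef_KL_ldesc\<close> the coefficient of \<open>v\<close> at \<open>z\<close>
  is the constant term at \<open>s z\<close>, which vanishes everywhere but at \<open>w\<close>.
  So a nonzero mu-coefficient forces the left descents of \<open>w\<close> to be left descents of
  \<open>z\<close>, apart from this one exception.\<close>

lemma KL_mu_ldesc:
  assumes "ldesc s w" "\<not> ldesc s z" "KL_mu z w \<noteq> 0"
  shows "of_gen s * z = w"
proof (rule ccontr)
  assume "of_gen s * z \<noteq> w"
  then have "coef (KL w) (of_gen s * z) \<in> v_Zv" using is_KL_KL[of w] by (simp add: is_KL_iff)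
  then show False
    using assms coef_KL_ldesc[OF assms(1,2)] by (simp add: vv_def lookup_single_mult v_Zv_iff)
qed

section \<open>The left descents of the special elements\<close>

lemma x_elt_Suc: "x_elt (Suc n) = x_elt n * of_gen (a_seq (Suc n))"
  by (simp add: x_elt_def)

lemma phi_x_elt_Suc: "phi (x_elt (Suc n)) = phi (x_elt n) * of_gen (swap01 (a_seq (Suc n)))"
  by (simp add: x_elt_Suc phi_mult phi_of_gen)

lemma x_elt_6_add: "x_elt (6 + n) = x_elt 6 * x_elt n"
proof (induction n)
  case 0
  show ?case by (simp add: x_elt_def)
next
  case (Suc n)
  have "a_seq (Suc (6 + n)) = a_seq (Suc n)" by (simp add: a_seq_def)
  then show ?case using Suc by (simp only: add_Suc_right x_elt_Suc mult.assoc)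
qed

lemma phi_one: "phi 1 = 1"
  by transfer (simp add: word_eq.refl)

text \<open>The images of the base point form an infinite walk through the triangles of the tiling.
  One period of the word is the translation by \<open>(6, 6)\<close>, so that finitely many
  positions determine on which side of a mirror the walk stays.\<close>

definition walk :: "nat \<Rightarrow> int \<times> int" where
  "walk n = action (phi (x_elt n)) (1, 2)"

lemma walk_small: "walk 0 = (1, 2)" "walk 1 = (1, 4)" "walk 2 = (2, 5)" "walk 3 = (4, 5)"
  "walk 4 = (4, 7)" "walk 5 = (5, 8)"
  by (simp_all add: walk_def x_elt_def a_seq_def upt_rec phi_mult phi_of_gen phi_one)

lemma walk_6_add: "walk (6 + n) = (fst (walk n) + 6, snd (walk n) + 6)"
  by (cases "walk n", simp only: walk_def x_elt_6_add phi_mult action_simps)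
    (simp add: x_elt_def a_seq_def upt_rec phi_mult phi_of_gen phi_one)

lemma walk_bounds:
  assumes "walk n = (x, y)"
  shows "0 < x" "x < y" "y < x + 6" "n \<ge> 1 \<Longrightarrow> 3 < y"
proof -
  have "0 < fst (walk n) \<and> fst (walk n) < snd (walk n) \<and> snd (walk n) < fst (walk n) + 6 \<and>
    (n \<ge> 1 \<longrightarrow> 3 < snd (walk n))"
  proof (induction n rule: less_induct)
    case (less n)
    show ?case
    proof (cases "n < 6")
      case True
      then have "n = 0 \<or> n = 1 \<or> n = 2 \<or> n = 3 \<or> n = 4 \<or> n = 5" by linarith
      then show ?thesis using walk_small by auto
    next
      case False
      then have "n = 6 + (n - 6)" by simp
      then show ?thesis using less[of "n - 6"] walk_6_add[of "n - 6"] False by simp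
    qed
  qed
  then show "0 < x" "x < y" "y < x + 6" "n \<ge> 1 \<Longrightarrow> 3 < y" using assms by auto
qed

text \<open>The prefix \<open>y\<close> moves the whole walk. The descent \<open>s\<close> never
  appears as long as the moved walk stays on the positive side of the mirror of
  \<open>s\<close>.\<close>

lemma not_ldesc_walk:
  assumes "\<not> ldesc s (y * phi (x_elt m))" "m \<le> n"
    "\<And>k. m \<le> k \<Longrightarrow> 0 < wall s (action y (walk k))"
  shows "\<not> ldesc s (y * phi (x_elt n))"
  using assms(2)
proof (induction n rule: dec_induct)
  case (step n)
  have "0 < wall s (action (y * phi (x_elt k)) (1, 2))" if "m \<le> k" for k
    using assms(3)[OF that] by (simp add: walk_def)
  from not_ldesc_step[OF step(3) this[of n], of "swap01 (a_seq (Suc n))"] this[of "Suc n"] step(1)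
  show ?case by (simp add: phi_x_elt_Suc mult.assoc)
qed (rule assms(1))

lemma x_elt_not_ldesc:
  "\<not> ldesc S1 (phi (x_elt n))" "\<not> ldesc S2 (phi (x_elt n))"
proof -
  have *: "\<not> ldesc s (phi (x_elt n))" if "\<And>k. 0 < wall s (walk k)" for s
    using not_ldesc_walk[of s 1 0 n] that by (simp add: x_elt_def phi_one ldesc_def)
  have "0 < wall S1 (walk k)" "0 < wall S2 (walk k)" for k
    using walk_bounds[of k] by (cases "walk k"; simp)+
  then show "\<not> ldesc S1 (phi (x_elt n))" "\<not> ldesc S2 (phi (x_elt n))" using * by blast+
qed

lemma e_elt_ldesc_S1: "ldesc S1 (e_elt n)"
  using x_elt_not_ldesc(1) by (simp add: e_elt_def)

lemma e_elt_not_ldesc_S2: "\<not> ldesc S2 (e_elt n)"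
proof -
  have "0 < wall S2 (action (of_gen S1) (walk k))" for k
    using walk_bounds[of k] by (cases "walk k") simp
  then show ?thesis
    using not_ldesc_walk[of S2 "of_gen S1" 0 n]
    by (simp add: e_elt_def x_elt_def phi_one ldesc_def)
qed

text \<open>Since \<open>s\<^sub>0\<close> and \<open>s\<^sub>1\<close> commute, \<open>s\<^sub>0
  e\<^sub>n = s\<^sub>1 s\<^sub>0 x'\<^sub>n\<close>, and the first letter
  \<open>s\<^sub>0\<close> of \<open>x'\<^sub>n\<close> cancels. Hence the moved walk is followed
  from its first step on, where it has crossed to the positive side of the mirror of
  \<open>s\<^sub>0\<close>. With \<open>n = 0\<close> there would be no letter to cancel.\<close>

lemma S0_e_elt_not_ldesc:
  assumes "n \<ge> 1"
  shows "\<not> ldesc S0 (of_gen S0 * e_elt n)" "\<not> ldesc S2 (of_gen S0 * e_elt n)"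
proof -
  let ?y = "of_gen S1 * of_gen S0"
  have eq: "of_gen S0 * e_elt n = ?y * phi (x_elt n)"
    unfolding e_elt_def weyl_braid(3) mult.assoc ..
  have "?y * phi (x_elt 1) = of_gen S1"
    by (simp add: x_elt_def a_seq_def phi_of_gen mult.assoc)
  then have *: "\<not> ldesc s (of_gen S0 * e_elt n)"
    if "s \<noteq> S1" "\<And>k. 1 \<le> k \<Longrightarrow> 0 < wall s (action ?y (walk k))" for s
    using that not_ldesc_walk[of s ?y 1 n] assms unfolding eq by (simp add: ldesc_def)
  have "0 < wall S0 (action ?y (walk k)) \<and> 0 < wall S2 (action ?y (walk k))" if "1 \<le> k" for k
    using walk_bounds[of k] that by (cases "walk k") simp
  then show "\<not> ldesc S0 (of_gen S0 * e_elt n)" "\<not> ldesc S2 (of_gen S0 * e_elt n)"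
    using *[of S0] *[of S2] by simp_all
qed

text \<open>The left descents \<open>s\<^sub>0\<close> and \<open>s\<^sub>1\<close> of
  \<open>e\<^sub>n\<close> pass to \<open>z\<close>: the exceptions in \<open>KL_mu_ldesc\<close>
  are \<open>z = s\<^sub>0 e\<^sub>n\<close> and \<open>z = s\<^sub>1 e\<^sub>n\<close>, which do
  not have the left descent \<open>s\<^sub>2\<close>. Together with \<open>s\<^sub>2\<close>, all
  generators are then left descents of \<open>z\<close>, and this is impossible.\<close>

lemma KL_mu_e_elt:
  assumes "n \<ge> 1" "ldesc S2 z"
  shows "KL_mu z (e_elt n) = 0"
proof (rule ccontr)
  assume mu: "KL_mu z (e_elt n) \<noteq> 0"
  have "ldesc S0 (e_elt n)"
    using S0_e_elt_not_ldesc(1)[OF assms(1)] by simp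
  then have "ldesc S0 z"
    using KL_mu_ldesc[OF _ _ mu, of S0] assms(2) S0_e_elt_not_ldesc(2)[OF assms(1)]
    by (metis weyl_cancel(3))
  moreover have "ldesc S1 z"
  proof (rule ccontr)
    assume "\<not> ldesc S1 z"
    from KL_mu_ldesc[OF e_elt_ldesc_S1 this mu] have "z = phi (x_elt n)"
      by (simp add: e_elt_def)
    then show False using assms(2) x_elt_not_ldesc(2) by simp
  qed
  ultimately have "ldesc s z" for s using assms(2) by (cases s) simp_all
  then show False using not_all_ldesc by blast
qed

theorem theorem5p8:
  fixes n :: nat
  assumes "n \<ge> 1"
  shows "KL (w_elt n) = KL (of_gen S2) * KL (e_elt n)"
proof -
  have "KL (of_gen S2) * KL (e_elt n) = KL (of_gen S2 * e_elt n) +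
      (\<Sum>z | z < e_elt n \<and> ldesc S2 z.
        scal (Poly_Mapping.single 0 (KL_mu z (e_elt n))) * KL z)"
    unfolding KL_of_gen by (rule KL_mult_gen[OF e_elt_not_ldesc_S2])
  also have "(\<Sum>z | z < e_elt n \<and> ldesc S2 z.
      scal (Poly_Mapping.single 0 (KL_mu z (e_elt n))) * KL z) = 0"
    using KL_mu_e_elt[OF assms] by (intro sum.neutral) simp
  finally show ?thesis by (simp add: w_elt_def)
qed

end
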